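(* Let $f_0:[0,1]\to\mathbb R$ be a strictly positive probability density which is $\alpha$-Hölder continuous for some $\alpha\in(0,1]$, i.e. there is $L_0>0$ with $|f_0(x)-f_0(y)|\le L_0|x-y|^\alpha$ for all $x,y\in[0,1]$, and let $\boldsymbol{x}=(x_1,\dots,x_n)$ be an i.i.d. sample from $f_0$. Consider the random irregular histogram prior sequence described in the context, and assume: (i) for each $n$, $p_n(k)$ is fully supported on $\{1,\dots,k_n\}$, where $k_n=O(n)$ and, for every $\gamma\in(0,1)$, $n^\gamma=O(k_n)$; moreover there are positive constants $D_1,D_2,d_1,d_2$ such that for all $n$ and all $k\le k_n$, $$D_1\exp(-d_1k\log k)\le p_n(k)\le D_2\exp(-d_2 k\log k);$$ (ii) conditional on $\mathcal I\in\mathcal P_{\mathcal T_n,k}$, the prior on $\boldsymbol\theta$ is $\mathrm{Dir}(\boldsymbol a)$ with $\sigma k^{-1}\le a_j\le\Sigma$ for all $j$, for constants $\sigma,\Sigma>0$; (iii) the grids satisfy $\max_{1\le j\le k_n}(\tau_{n,j}-\tau_{n,j-1})=O(k_n^{-1})$ and $\min_{1\le j\le k_n}(\tau_{n,j}-\tau_{n,j-1})\ge Bk_n^{-1}$ for some constant $B>0$. Then, with $\epsilon_n=\{n/\log n\}^{-\alpha/(2\alpha+1)}$, the Bayes histogram estimator satisfies $$\mathbb{E}_{\boldsymbol{x}\sim f_0}\Big\{d_H^{2}\big(f_0,\widehat f_{\widehat{\mathcal I}}\big)\Big\}=O(\epsilon_n^2).$$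
   Context: Grid: for each $n$, $\mathcal{T}_n=\{\tau_{n,j}:0\le j\le k_n\}$ with $0=\tau_{n,0}<\tau_{n,1}<\dots<\tau_{n,k_n}=1$, $k_n$ a positive integer. $\mathcal{P}_{\mathcal{T}_n,k}$ is the set of partitions of $[0,1]$ into $k$ intervals $\mathcal I=(\mathcal I_1,\dots,\mathcal I_k)$ whose endpoints lie in $\mathcal{T}_n$ (so $|\mathcal{P}_{\mathcal{T}_n,k}|=\binom{k_n-1}{k-1}$), and $\mathcal{P}_{\mathcal{T}_n}=\bigcup_{k=1}^{k_n}\mathcal{P}_{\mathcal{T}_n,k}$. For $\mathcal I\in\mathcal P_{\mathcal T_n,k}$ and $\boldsymbol\theta$ in the simplex $\mathcal S_k=\{\boldsymbol\theta\in[0,1]^k:\sum_j\theta_j=1\}$, the histogram density is $f(x\mid\mathcal I,\boldsymbol\theta)=\sum_{j=1}^k \frac{\theta_j}{|\mathcal I_j|}\mathbb 1_{\mathcal I_j}(x)$, $x\in[0,1]$. Random irregular histogram prior $P_n$: $k\sim p_n(k)$ on $\{1,\dots,k_n\}$; $\mathcal I\mid k$ uniform on $\mathcal P_{\mathcal T_n,k}$; $\boldsymbol\theta\mid\mathcal I\sim\mathrm{Dir}(a_1,\dots,a_k)$ with $a_j>0$ (possibly depending on $\mathcal I$), $a=\sum_j a_j$; data $x_i\mid f$ i.i.d. from $f(\cdot\mid\mathcal I,\boldsymbol\theta)$. With bin counts $N_j=\sum_{i=1}^n\mathbb 1_{\mathcal I_j}(x_i)$, the posterior probability of $\mathcal I\in\mathcal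 P_{\mathcal T_n,k}$ is $$p_n(\mathcal I\mid\boldsymbol x)\propto \frac{p_n(k)}{\prod_{j=1}^k|\mathcal I_j|^{N_j}}\,\frac{\prod_{j=1}^k\Gamma(a_j+N_j)}{\prod_{j=1}^k\Gamma(a_j)}\,\frac{\Gamma(a)}{\Gamma(a+n)}\binom{k_n-1}{k-1}^{-1}.$$ The MAP partition is $\widehat{\mathcal I}\in\arg\max_{\mathcal I\in\mathcal P_{\mathcal T_n}}p_n(\mathcal I\mid\boldsymbol x)$ (any maximizer). The Bayes histogram estimator is $\widehat f_{\widehat{\mathcal I}}(x)=\sum_{j=1}^{k}\frac{\widehat\theta_j}{|\widehat{\mathcal I}_j|}\mathbb 1_{\widehat{\mathcal I}_j}(x)$, where $k$ is the number of bins of $\widehat{\mathcal I}$ and $\widehat\theta_j=(a_j+N_j)/(a+n)$ computed for $\widehat{\mathcal I}$ (the posterior mean of $\theta_j$). The Hellinger distance is $d_H(f,g)=\big(\int_0^1(\sqrt{f}-\sqrt{g})^2\,\mathrm dx\big)^{1/2}$. *)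

theory Defs
  imports "HOL-Probability.Probability" "HOL-Library.Landau_Symbols"
begin

text \<open>A partition of [0,1] with endpoints in the grid tau_{n,0..K} (K = k_n) is encoded as the
  strictly increasing list js of grid indices of its endpoints, js = [0 = j_0 < j_1 < ... < j_k = K].
  It has k = length js - 1 bins; bin j (1 <= j <= k) is [tau(j_{j-1}), tau(j_j)), the last bin
  being closed at 1.\<close>

definition grid_partition :: "nat \<Rightarrow> nat list \<Rightarrow> bool" where
  "grid_partition K js \<longleftrightarrow> length js \<ge> 2 \<and> js ! 0 = 0 \<and> last js = K \<and> sorted_wrt (<) js"

definition partitions :: "nat \<Rightarrow> nat list set" where
  "partitions K = {js. grid_partition K js}"

definition nbins :: "nat list \<Rightarrow> nat" where
  "nbins js = length js - 1"

definition bin :: "(nat \<Rightarrow> real) \<Rightarrow> nat list \<Rightarrow> nat \<Rightarrow> real set" where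
  "bin tau js j = (if j = nbins js then {tau (js ! (j - 1)) .. tau (js ! j)}
                   else {tau (js ! (j - 1)) ..< tau (js ! j)})"

definition binlen :: "(nat \<Rightarrow> real) \<Rightarrow> nat list \<Rightarrow> nat \<Rightarrow> real" where
  "binlen tau js j = tau (js ! j) - tau (js ! (j - 1))"

definition bincount :: "nat \<Rightarrow> (nat \<Rightarrow> real) \<Rightarrow> (nat \<Rightarrow> real) \<Rightarrow> nat list \<Rightarrow> nat \<Rightarrow> nat" where
  "bincount n x tau js j = card {i. i < n \<and> x i \<in> bin tau js j}"

text \<open>Unnormalised posterior probability of partition js given the sample.
  p = p_n (prior on k), a = Dirichlet parameters (a j for bin j), K = k_n.\<close>
definition post_score :: "nat \<Rightarrow> nat \<Rightarrow> (nat \<Rightarrow> real) \<Rightarrow> (nat \<Rightarrow> real) \<Rightarrow> (nat \<Rightarrow> real)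
    \<Rightarrow> (nat \<Rightarrow> real) \<Rightarrow> nat list \<Rightarrow> real" where
  "post_score n K p a tau x js =
     (let k = nbins js; N = bincount n x tau js; A = (\<Sum>j=1..k. a j) in
      p k / (\<Prod>j=1..k. binlen tau js j ^ N j)
        * ((\<Prod>j=1..k. Gamma (a j + real (N j))) / (\<Prod>j=1..k. Gamma (a j)))
        * (Gamma A / Gamma (A + real n))
        / real ((K - 1) choose (k - 1)))"

definition map_partitions :: "nat \<Rightarrow> nat \<Rightarrow> (nat \<Rightarrow> real) \<Rightarrow> (nat list \<Rightarrow> nat \<Rightarrow> real)
    \<Rightarrow> (nat \<Rightarrow> real) \<Rightarrow> (nat \<Rightarrow> real) \<Rightarrow> nat list set" where
  "map_partitions n K p a tau x =
     {js \<in> partitions K. \<forall>js' \<in> partitions K.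
         post_score n K p (a js') tau x js' \<le> post_score n K p (a js) tau x js}"

text \<open>Bayes histogram estimator for partition js (posterior mean of theta).\<close>
definition hist_est :: "nat \<Rightarrow> (nat \<Rightarrow> real) \<Rightarrow> (nat \<Rightarrow> real) \<Rightarrow> (nat \<Rightarrow> real) \<Rightarrow> nat list
    \<Rightarrow> real \<Rightarrow> real" where
  "hist_est n a tau x js t =
     (let k = nbins js; N = bincount n x tau js; A = (\<Sum>j=1..k. a j) in
      \<Sum>j=1..k. (a j + real (N j)) / (A + real n) / binlen tau js j * indicator (bin tau js j) t)"

definition hellinger_sq :: "(real \<Rightarrow> real) \<Rightarrow> (real \<Rightarrow> real) \<Rightarrow> real" where
  "hellinger_sq f g = (LINT t:{0..1}|lborel. (sqrt (f t) - sqrt (g t))^2)"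

text \<open>Worst squared Hellinger loss over all MAP partitions (covers "any maximiser").\<close>
definition map_loss :: "(real \<Rightarrow> real) \<Rightarrow> nat \<Rightarrow> nat \<Rightarrow> (nat \<Rightarrow> real) \<Rightarrow> (nat list \<Rightarrow> nat \<Rightarrow> real)
    \<Rightarrow> (nat \<Rightarrow> real) \<Rightarrow> (nat \<Rightarrow> real) \<Rightarrow> real" where
  "map_loss f0 n K p a tau x =
     Max ((\<lambda>js. hellinger_sq f0 (hist_est n (a js) tau x js)) ` map_partitions n K p a tau x)"

definition obs_measure :: "(real \<Rightarrow> real) \<Rightarrow> real measure" where
  "obs_measure f0 = density lborel (\<lambda>t. ennreal (f0 t) * indicator {0..1} t)"

definition sample_measure :: "(real \<Rightarrow> real) \<Rightarrow> nat \<Rightarrow> (nat \<Rightarrow> real) measure" where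
  "sample_measure f0 n = PiM {..<n} (\<lambda>_. obs_measure f0)"

end

theory Submission
  imports Defs "HOL-Real_Asymp.Real_Asymp"
begin

text \<open>
  The marginal likelihood of a partition is a Dirichlet--multinomial weight divided by the bin widths,
  and the Dirichlet--multinomial weight is the law of a Polya urn. Hence for every partition \<open>I\<close> the
  ratios of its marginal likelihood to the likelihoods of \<open>f\<close> and of the projection \<open>f\<^sub>I\<close> of \<open>f\<close>
  onto \<open>I\<close> have expectation at most 1; so has
  \<open>exp (n H / 2) * \<Prod>\<^sub>i sqrt (f\<^sub>I (x\<^sub>i) / f (x\<^sub>i))\<close>, where \<open>H\<close> is the squared Hellinger distance of
  \<open>f\<close> and \<open>f\<^sub>I\<close>. Averaging these over partitions (with weights
  \<open>p k / binom (K - 1) (k - 1)\<close> and \<open>1 / (K binom (K - 1) (k - 1))\<close>) and applying Markov's inequality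
  bounds all of them simultaneously. A quasi-uniform partition with about
  \<open>r = (n / log n) powr (1 / (2\<alpha> + 1))\<close> bins has posterior score at least
  \<open>exp (- C r log n)\<close> times the likelihood of \<open>f\<close>, so the MAP partition does too. This forces it to have
  \<open>O (r)\<close> bins; the lower bound of the marginal likelihood by the maximised likelihood, up to a factor
  \<open>exp (- C k log n)\<close>, controls the empirical bin frequencies, and the third ratio controls the
  approximation error. Off the Markov events the loss is \<open>O (r log n / n)\<close>, and it never exceeds 2.
\<close>

text \<open>The obstacle is that the MAP partition is selected by the data among exponentially many.
  Bounds for a fixed partition survive the selection because, in the second and third averages, a
  partition with \<open>k\<close> bins has weight at least \<open>exp (- 2 * k * log n)\<close>.
  That price has the same order as the Dirichlet terms, and it is harmless once \<open>k\<close> is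
  O(r). The second ratio compares with the projection rather than with the density itself: both give
  the bins the same masses, so the bin counts have the same law under both and the excess of the
  maximised likelihood measures only the error of the frequencies. The third ratio needs the square
  root: projection over density has expectation exactly 1 and shows no gain, while its root has the
  Hellinger affinity as expectation. The size r solves n r^(-2 \<alpha>) = r log n: n times the
  squared Hoelder bias of r bins equals the logarithmic price of r bins, and both equal n times the
  squared rate. Strict positivity enters through a uniform lower bound of the density, which makes a
  chi-square divergence finite and small.\<close>

section \<open>Counting grid partitions, and a quasi-uniform one\<close>

lemma partitionsD:
  assumes "js \<in> partitions K"
  shows "nbins js \<ge> 1" "js ! 0 = 0" "js ! nbins js = K" "length js = Suc (nbins js)"
    "\<And>i j. i < j \<Longrightarrow> j \<le> nbins js \<Longrightarrow> js ! i < js ! j"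
    "\<And>i. i \<le> nbins js \<Longrightarrow> js ! i \<le> K"
proof -
  have gp: "length js \<ge> 2" "js ! 0 = 0" "last js = K" "sorted_wrt (<) js"
    using assms by (auto simp: partitions_def grid_partition_def)
  show "nbins js \<ge> 1" "js ! 0 = 0" using gp by (auto simp: nbins_def)
  show len: "length js = Suc (nbins js)" using gp by (auto simp: nbins_def)
  show last: "js ! nbins js = K" using gp by (subst (asm) last_conv_nth) (auto simp: nbins_def)
  show less: "js ! i < js ! j" if "i < j" "j \<le> nbins js" for i j
    using gp(4) that len by (auto simp: sorted_wrt_iff_nth_less)
  show "js ! i \<le> K" if "i \<le> nbins js" for i
    using less[of i "nbins js"] last that by (cases "i = nbins js") auto
qed

lemma partitions_nbins_le:
  assumes "js \<in> partitions K"
  shows "nbins js \<le> K"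
proof -
  have "i \<le> js ! i" if "i \<le> nbins js" for i
    using that
  proof (induction i)
    case (Suc i)
    then show ?case using partitionsD(5)[OF assms, of i "Suc i"] by simp
  qed simp
  then show ?thesis using partitionsD(3)[OF assms] by (metis order_refl)
qed

text \<open>A partition is determined by its set of interior knots, a \<open>(k - 1)\<close>-subset
  of \<open>{1..K-1}\<close>. Injectivity of this map suffices for the bound that the averaging
  uses.\<close>

lemma finite_partitions: "finite (partitions K)"
  and card_partitions_nbins:
    "k \<ge> 1 \<Longrightarrow> card {js \<in> partitions K. nbins js = k} \<le> (K - 1) choose (k - 1)"
proof -
  let ?g = "\<lambda>js. set js - {0, K}"
  have set_eq: "set js = insert 0 (insert K (?g js))" if "js \<in> partitions K" for js
  proof -
    note D = partitionsD[OF that]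
    have "0 \<in> set js" "K \<in> set js"
      using D(2,3,4) nth_mem[of 0 js] nth_mem[of "nbins js" js] by auto
    then show ?thesis by auto
  qed
  have inj: "inj_on ?g (partitions K)"
  proof (rule inj_onI)
    fix js js' assume *: "js \<in> partitions K" "js' \<in> partitions K" "?g js = ?g js'"
    then have "set js = set js'" using set_eq by metis
    moreover have "sorted_wrt (<) js" "sorted_wrt (<) js'"
      using * by (auto simp: partitions_def grid_partition_def)
    ultimately show "js = js'" using strict_sorted_equal by blast
  qed
  have le: "set js \<subseteq> {0..K}" if "js \<in> partitions K" for js
    using partitionsD(4,6)[OF that] by (auto simp: in_set_conv_nth)
  have sub: "?g js \<in> Pow {1..K-1}" if "js \<in> partitions K" for js
    using le[OF that] by force
  show "finite (partitions K)"
    using inj by (rule inj_on_finite[where B = "Pow {1..K-1}"]) (use sub in auto)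
  assume k: "k \<ge> 1"
  have card: "card (?g js) = k - 1" if "js \<in> partitions K" "nbins js = k" for js
  proof -
    note D = partitionsD[OF that(1)]
    have "sorted_wrt (<) js" using that by (auto simp: partitions_def grid_partition_def)
    then have "distinct js" by (simp add: strict_sorted_iff)
    then have "card (set js) = Suc k" using D(4) that by (simp add: distinct_card)
    moreover have "K \<noteq> 0" using D(5)[of 0 "nbins js"] D(1,2,3) by auto
    moreover have "0 \<in> set js" "K \<in> set js" using set_eq[OF that(1)] by blast+
    ultimately show ?thesis by (simp add: card_Diff_subset)
  qed
  have "card {js \<in> partitions K. nbins js = k} \<le> card {S. S \<subseteq> {1..K-1} \<and> card S = k - 1}"
  proof (rule card_inj_on_le)
    show "inj_on ?g {js \<in> partitions K. nbins js = k}"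
      using inj by (rule inj_on_subset) auto
    show "?g ` {js \<in> partitions K. nbins js = k} \<subseteq> {S. S \<subseteq> {1..K-1} \<and> card S = k - 1}"
      using sub card by auto
  qed simp
  also have "\<dots> = (K - 1) choose (k - 1)"
    using n_subsets[of "{1..K-1}" "k - 1"] by simp
  finally show "card {js \<in> partitions K. nbins js = k} \<le> (K - 1) choose (k - 1)" .
qed

text \<open>Shares a weight on the number of bins evenly among the partitions with that number. It
  serves for the prior, truncated to many bins, and for the uniform weight
  \<open>1 / K\<close>.\<close>

lemma sum_partitions_le:
  fixes g :: "nat \<Rightarrow> real"
  assumes "\<And>k. k \<in> {1..K} \<Longrightarrow> g k \<ge> 0"
  shows "(\<Sum>js\<in>partitions K. g (nbins js) / real ((K - 1) choose (nbins js - 1))) \<le> (\<Sum>k=1..K. g k)"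
proof -
  have "(\<Sum>js\<in>partitions K. g (nbins js) / real ((K - 1) choose (nbins js - 1)))
    = (\<Sum>k=1..K. \<Sum>js\<in>{js \<in> partitions K. nbins js = k}. g (nbins js) / real ((K - 1) choose (nbins js - 1)))"
    by (rule sum.group[symmetric])
      (use finite_partitions partitionsD(1) partitions_nbins_le in auto)
  also have "\<dots> \<le> (\<Sum>k=1..K. g k)"
  proof (rule sum_mono)
    fix k assume k: "k \<in> {1..K}"
    have b: "(K - 1) choose (k - 1) > 0" using k by (simp add: zero_less_binomial_iff diff_le_mono)
    have "(\<Sum>js\<in>{js \<in> partitions K. nbins js = k}. g (nbins js) / real ((K - 1) choose (nbins js - 1)))
      = real (card {js \<in> partitions K. nbins js = k}) * (g k / real ((K - 1) choose (k - 1)))"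
      by simp
    also have "\<dots> \<le> real ((K - 1) choose (k - 1)) * (g k / real ((K - 1) choose (k - 1)))"
      using card_partitions_nbins[of k K] k assms[OF k] by (intro mult_right_mono) auto
    also have "\<dots> = g k" using b by simp
    finally show "(\<Sum>js\<in>{js \<in> partitions K. nbins js = k}. g (nbins js) / real ((K - 1) choose (nbins js - 1))) \<le> g k" .
  qed
  finally show ?thesis .
qed

text \<open>Knots at the integer parts of \<open>i * K / k\<close>. Neighbours differ by at least 1
  because \<open>k \<le> K\<close>, and by at most \<open>K / k + 1\<close>, hence at most
  \<open>2 * K / k\<close>.\<close>

lemma quasi_uniform_partition:
  assumes "1 \<le> k" "k \<le> K"
  obtains js where "js \<in> partitions K" "nbins js = k"
    "\<And>j. 1 \<le> j \<Longrightarrow> j \<le> k \<Longrightarrow> real (js ! j - js ! (j - 1)) \<le> 2 * real K / real k"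
proof
  define js where "js = map (\<lambda>i. (i * K) div k) [0..<Suc k]"
  have nth: "js ! i = (i * K) div k" if "i \<le> k" for i
    unfolding js_def by (subst nth_map) (use that in \<open>auto simp del: upt_Suc\<close>)
  have len: "length js = Suc k" by (simp add: js_def)
  have less: "(i * K) div k < (j * K) div k" if "i < j" for i j
  proof -
    have "i * K + k \<le> (i + 1) * K" using assms by simp
    also have "\<dots> \<le> j * K" using that by (intro mult_right_mono) auto
    finally have "(i * K + k) div k \<le> (j * K) div k" by (rule div_le_mono)
    then show ?thesis using assms by simp
  qed
  have "sorted_wrt (<) js"
    unfolding sorted_wrt_iff_nth_less using len nth less by auto
  moreover have "last js = K" using len nth[of k] assms by (subst last_conv_nth) auto
  ultimately show "js \<in> partitions K"
    using assms nth[of 0] len by (auto simp: partitions_def grid_partition_def)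
  show "nbins js = k" using len by (simp add: nbins_def)
  fix j assume j: "1 \<le> j" "j \<le> k"
  have 1: "real ((j * K) div k) \<le> real (j * K) / real k"
    by (rule of_nat_div_le_of_nat)
  have "(j - 1) * K < ((j - 1) * K div k + 1) * k"
    using dividend_less_div_times[of k "(j - 1) * K"] assms by (simp add: algebra_simps)
  then have "real ((j - 1) * K) < real (((j - 1) * K div k + 1) * k)"
    by (rule of_nat_less_iff[THEN iffD2])
  then have 2: "real (((j - 1) * K) div k) \<ge> real ((j - 1) * K) / real k - 1"
    using assms by (simp add: divide_le_eq algebra_simps del: of_nat_diff)
  have 3: "real (js ! j - js ! (j - 1)) = real ((j * K) div k) - real (((j - 1) * K) div k)"
    using j less[of "j-1" j] by (subst of_nat_diff) (auto simp: nth)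
  have "real (js ! j - js ! (j - 1)) \<le> real (j * K) / real k - (real ((j - 1) * K) / real k - 1)"
    using 1 2 3 by linarith
  also have "\<dots> = real K / real k + 1"
    using j by (simp add: field_simps of_nat_diff)
  also have "\<dots> \<le> 2 * real K / real k" using assms by (simp add: field_simps)
  finally show "real (js ! j - js ! (j - 1)) \<le> 2 * real K / real k" .
qed

section \<open>Bins as intervals: disjointness, covering and counts\<close>

locale grid =
  fixes K :: nat and tau :: "nat \<Rightarrow> real"
  assumes K_pos: "K \<ge> 1" and tau0: "tau 0 = 0" and tauK: "tau K = 1"
    and tau_step: "\<And>j. 1 \<le> j \<Longrightarrow> j \<le> K \<Longrightarrow> tau (j - 1) < tau j"
begin

lemma tau_less: "i < j \<Longrightarrow> j \<le> K \<Longrightarrow> tau i < tau j"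
proof (induction j)
  case (Suc j)
  then show ?case using tau_step[of "Suc j"] by (cases "i = j") (auto simp: less_Suc_eq)
qed simp

context
  fixes js assumes js: "js \<in> partitions K"
begin

lemma knot_less: "i < j \<Longrightarrow> j \<le> nbins js \<Longrightarrow> tau (js ! i) < tau (js ! j)"
  using partitionsD(5,6)[OF js] by (intro tau_less) auto

lemma knot_le: "i \<le> j \<Longrightarrow> j \<le> nbins js \<Longrightarrow> tau (js ! i) \<le> tau (js ! j)"
  using knot_less[of i j] by (cases "i = j") auto

lemma binlen_pos: "j \<in> {1..nbins js} \<Longrightarrow> binlen tau js j > 0"
  using knot_less[of "j - 1" j] by (auto simp: binlen_def)

lemma bin_subset:
  assumes "j \<in> {1..nbins js}"
  shows "bin tau js j \<subseteq> {0..1}"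
proof -
  have "j - 1 \<le> nbins js" "j \<le> nbins js" using assms by auto
  then have "0 \<le> tau (js ! (j - 1))" "tau (js ! j) \<le> 1"
    using knot_le[of 0 "j - 1"] knot_le[of j "nbins js"] partitionsD(2,3)[OF js] tau0 tauK by auto
  then show ?thesis by (auto simp: bin_def)
qed

lemma bin_disjoint: "disjoint_family_on (bin tau js) {1..nbins js}"
proof -
  have "bin tau js i \<inter> bin tau js j = {}" if "1 \<le> i" "i < j" "j \<le> nbins js" for i j
  proof -
    have "i \<le> j - 1" "j - 1 \<le> nbins js" "i \<noteq> nbins js" using that by auto
    then show ?thesis using knot_le[of i "j - 1"] by (auto simp: bin_def)
  qed
  then show ?thesis
    unfolding disjoint_family_on_def by (metis Int_commute atLeastAtMost_iff nat_neq_iff)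
qed

lemma bin_cover: "(\<Union>j\<in>{1..nbins js}. bin tau js j) = {0..1}"
proof
  show "(\<Union>j\<in>{1..nbins js}. bin tau js j) \<subseteq> {0..1}" using bin_subset by blast
  show "{0..1} \<subseteq> (\<Union>j\<in>{1..nbins js}. bin tau js j)"
  proof
    fix t :: real assume t: "t \<in> {0..1}"
    note D = partitionsD[OF js]
    show "t \<in> (\<Union>j\<in>{1..nbins js}. bin tau js j)"
    \<comment> \<open>The last bin contains its right end 1, so points beyond its left knot are
      treated apart. For any other point the first knot strictly to its right is the right end of
      its bin.\<close>
    proof (cases "t < tau (js ! (nbins js - 1))")
      case False
      then have "t \<in> bin tau js (nbins js)" using t D(3) tauK by (auto simp: bin_def)
      then show ?thesis using D(1) by auto
    next
      case True
      define j where "j = (LEAST j. t < tau (js ! j))"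
      have lt: "t < tau (js ! j)" unfolding j_def using True by (rule LeastI)
      have jle: "j \<le> nbins js - 1" unfolding j_def using True by (rule Least_le)
      have j0: "j \<noteq> 0" using lt t D(2) tau0 by (metis atLeastAtMost_iff not_less)
      have "\<not> t < tau (js ! (j - 1))"
        using j0 not_less_Least[of "j - 1" "\<lambda>j. t < tau (js ! j)"] unfolding j_def by auto
      then have "t \<in> bin tau js j" using lt by (auto simp: bin_def)
      then show ?thesis using j0 jle by (auto intro!: bexI[of _ j])
    qed
  qed
qed

lemma bin_borel[measurable]: "bin tau js j \<in> sets borel"
  by (auto simp: bin_def)

lemma bin_lborel: "j \<in> {1..nbins js} \<Longrightarrow> emeasure lborel (bin tau js j) = ennreal (binlen tau js j)"
  using knot_le[of "j - 1" j] by (auto simp: bin_def binlen_def)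

lemma bin_unique: "t \<in> {0..1} \<Longrightarrow> \<exists>!j. j \<in> {1..nbins js} \<and> t \<in> bin tau js j"
  using bin_cover bin_disjoint unfolding disjoint_family_on_def by blast

lemma sum_bin_indicator:
  fixes c :: "nat \<Rightarrow> real"
  assumes "j \<in> {1..nbins js}" "t \<in> bin tau js j"
  shows "(\<Sum>i=1..nbins js. c i * indicator (bin tau js i) t) = c j"
proof -
  have "(\<Sum>i=1..nbins js. c i * indicator (bin tau js i) t) = (\<Sum>i=1..nbins js. if i = j then c j else 0)"
  proof (rule sum.cong)
    fix i assume i: "i \<in> {1..nbins js}"
    show "c i * indicator (bin tau js i) t = (if i = j then c j else 0)"
      using bin_disjoint i assms unfolding disjoint_family_on_def
      by (cases "i = j") (fastforce simp: indicator_def)+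
  qed simp
  also have "\<dots> = c j" using assms by simp
  finally show ?thesis .
qed

text \<open>Points outside the unit interval lie in no bin, so only the inequality is unconditional.
  The urn induction and the crude bound 2 on the loss use it for every \<open>x\<close>, without
  passing to a set of full measure.\<close>

lemma sum_bincount_le: "(\<Sum>j=1..nbins js. bincount n x tau js j) \<le> n"
  and sum_bincount: "(\<And>i. i < n \<Longrightarrow> x i \<in> {0..1}) \<Longrightarrow> (\<Sum>j=1..nbins js. bincount n x tau js j) = n"
proof -
  have *: "(\<Sum>j=1..nbins js. bincount n x tau js j) = card (\<Union>j\<in>{1..nbins js}. {i. i < n \<and> x i \<in> bin tau js j})"
    unfolding bincount_def
    by (rule card_UN_disjoint[symmetric]) (use bin_disjoint in \<open>auto simp: disjoint_family_on_def\<close>)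
  also have "\<dots> \<le> card {..<n}" by (rule card_mono) auto
  finally show "(\<Sum>j=1..nbins js. bincount n x tau js j) \<le> n" by simp
  assume x: "\<And>i. i < n \<Longrightarrow> x i \<in> {0..1}"
  have "(\<Union>j\<in>{1..nbins js}. {i. i < n \<and> x i \<in> bin tau js j}) = {..<n}"
    using x bin_cover by blast
  with * show "(\<Sum>j=1..nbins js. bincount n x tau js j) = n" by simp
qed

lemma prod_bincount:
  fixes c :: "nat \<Rightarrow> real" and g :: "real \<Rightarrow> real"
  assumes x: "\<And>i. i < n \<Longrightarrow> x i \<in> {0..1}"
    and g: "\<And>j t. j \<in> {1..nbins js} \<Longrightarrow> t \<in> bin tau js j \<Longrightarrow> g t = c j"
  shows "(\<Prod>i<n. g (x i)) = (\<Prod>j=1..nbins js. c j ^ bincount n x tau js j)"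
proof -
  have U: "(\<Union>j\<in>{1..nbins js}. {i. i < n \<and> x i \<in> bin tau js j}) = {..<n}"
    using x bin_cover by blast
  have "(\<Prod>i<n. g (x i)) = (\<Prod>j=1..nbins js. \<Prod>i\<in>{i. i < n \<and> x i \<in> bin tau js j}. g (x i))"
    by (subst U[symmetric], rule prod.UNION_disjoint) (use bin_disjoint in \<open>auto simp: disjoint_family_on_def\<close>)
  also have "\<dots> = (\<Prod>j=1..nbins js. c j ^ bincount n x tau js j)"
  proof (rule prod.cong)
    fix j assume "j \<in> {1..nbins js}"
    then have "(\<Prod>i\<in>{i. i < n \<and> x i \<in> bin tau js j}. g (x i)) = (\<Prod>i\<in>{i. i < n \<and> x i \<in> bin tau js j}. c j)"
      using g by (intro prod.cong) auto
    then show "(\<Prod>i\<in>{i. i < n \<and> x i \<in> bin tau js j}. g (x i)) = c j ^ bincount n x tau js j"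
      by (simp add: bincount_def)
  qed simp
  finally show ?thesis .
qed

end

end

section \<open>Dirichlet--multinomial weights and the Polya urn\<close>

text \<open>For counts that sum to \<open>n\<close>, the probability that a Polya urn with initial
  weights \<open>a\<close> produces one given sequence of labels with these counts. The order of the
  labels is kept, hence no multinomial coefficient.\<close>

definition dirichlet_multinomial :: "(nat \<Rightarrow> real) \<Rightarrow> nat \<Rightarrow> nat \<Rightarrow> (nat \<Rightarrow> nat) \<Rightarrow> real" where
  "dirichlet_multinomial a k n N =
     (\<Prod>j=1..k. pochhammer (a j) (N j)) / pochhammer (\<Sum>j=1..k. a j) n"

lemma dirichlet_multinomial_pos:
  assumes "k \<ge> 1" "\<And>j. j \<in> {1..k} \<Longrightarrow> a j > 0"
  shows "dirichlet_multinomial a k n N > 0"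
proof -
  have "(\<Sum>j=1..k. a j) > 0" using assms by (intro sum_pos) auto
  then show ?thesis unfolding dirichlet_multinomial_def
    using assms by (intro divide_pos_pos prod_pos pochhammer_pos) auto
qed

lemma dirichlet_multinomial_step:
  assumes "i \<in> {1..k}" "\<And>j. j \<in> {1..k} \<Longrightarrow> a j > 0"
  shows "dirichlet_multinomial a k (Suc n) (N(i := Suc (N i)))
    = dirichlet_multinomial a k n N * ((a i + real (N i)) / ((\<Sum>j=1..k. a j) + real n))"
proof -
  have "(\<Prod>j=1..k. pochhammer (a j) ((N(i := Suc (N i))) j))
      = pochhammer (a i) (Suc (N i)) * (\<Prod>j\<in>{1..k}-{i}. pochhammer (a j) (N j))"
    using assms(1) by (subst prod.remove[of _ i]) auto
  also have "\<dots> = (a i + real (N i)) * (\<Prod>j=1..k. pochhammer (a j) (N j))"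
    using assms(1) by (simp add: prod.remove[of _ i] pochhammer_Suc)
  finally show ?thesis by (simp add: dirichlet_multinomial_def pochhammer_Suc)
qed

lemma Gamma_ratio_eq_pochhammer:
  fixes z :: real assumes "z > 0" shows "Gamma (z + real n) / Gamma z = pochhammer z n"
  using pochhammer_Gamma[of z n] assms nonpos_Ints_nonpos by force

text \<open>Rising factorials replace the quotients of Gamma values because they obey the one-step
  recursion of the urn. The score then factors into prior weight and marginal likelihood.\<close>

lemma post_score_eq:
  assumes "nbins js \<ge> 1" "\<And>j. j \<in> {1..nbins js} \<Longrightarrow> a j > 0"
  shows "post_score n K p a tau x js = p (nbins js) / real ((K - 1) choose (nbins js - 1))
    * (dirichlet_multinomial a (nbins js) n (bincount n x tau js)
       / (\<Prod>j=1..nbins js. binlen tau js j ^ bincount n x tau js j))"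
proof -
  let ?A = "\<Sum>j=1..nbins js. a j"
  have A: "?A > 0" using assms by (intro sum_pos) auto
  have "Gamma ?A / Gamma (?A + real n) = inverse (pochhammer ?A n)"
    using Gamma_ratio_eq_pochhammer[OF A, of n] by (metis inverse_divide)
  moreover have "(\<Prod>j=1..nbins js. Gamma (a j + real (bincount n x tau js j))) / (\<Prod>j=1..nbins js. Gamma (a j))
      = (\<Prod>j=1..nbins js. pochhammer (a j) (bincount n x tau js j))"
    unfolding prod_dividef[symmetric] using assms by (intro prod.cong Gamma_ratio_eq_pochhammer) auto
  ultimately show ?thesis
    unfolding post_score_def Let_def dirichlet_multinomial_def
    by (simp only: divide_inverse inverse_mult_distrib inverse_inverse_eq mult_ac)
qed

lemma measurable_bincount[measurable]:
  assumes [measurable]: "\<And>j. bin tau js j \<in> sets borel" and "n \<le> m" and "sets M = sets borel"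
  shows "(\<lambda>x. bincount n x tau js j) \<in> measurable (PiM {..<m} (\<lambda>_. M)) (count_space UNIV)"
proof -
  have "bincount n x tau js j = (\<Sum>i<n. if x i \<in> bin tau js j then 1 else 0)" for x
    by (simp add: bincount_def sum.If_cases Int_def)
  moreover have "(\<lambda>x. \<Sum>i<n. if x i \<in> bin tau js j then 1 else 0 :: nat)
      \<in> measurable (PiM {..<m} (\<lambda>_. M)) (count_space UNIV)"
  proof (rule measurable_sum_nat)
    fix i assume "i \<in> {..<n}"
    then have [measurable]: "(\<lambda>x. x i) \<in> measurable (PiM {..<m} (\<lambda>_. M)) borel"
      using assms(2) measurable_component_singleton[of i "{..<m}" "\<lambda>_. M"]
      by (simp add: measurable_cong_sets[OF refl assms(3)])
    show "(\<lambda>x. if x i \<in> bin tau js j then 1 else 0) \<in> measurable (PiM {..<m} (\<lambda>_. M)) (count_space UNIV)"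
      by measurable
  qed
  ultimately show ?thesis by simp
qed

lemma measurable_dirichlet_multinomial:
  assumes "\<And>j. (\<lambda>x. N x j) \<in> measurable M (count_space UNIV)"
  shows "(\<lambda>x. dirichlet_multinomial a k n (N x)) \<in> borel_measurable M"
proof -
  have [measurable]: "(\<lambda>x. pochhammer (a j) (N x j)) \<in> borel_measurable M" for j
    using assms by (rule measurable_compose) simp
  show ?thesis unfolding dirichlet_multinomial_def by measurable
qed

context grid
begin

lemma bincount_Suc_upd:
  assumes "js \<in> partitions K" "j \<in> {1..nbins js}" "y \<in> bin tau js j" "i \<in> {1..nbins js}"
  shows "bincount (Suc n) (x(n := y)) tau js i = ((bincount n x tau js)(j := Suc (bincount n x tau js j))) i"
proof -
  have "y \<in> bin tau js i \<longleftrightarrow> i = j"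
    using bin_disjoint[OF assms(1)] assms unfolding disjoint_family_on_def by blast
  then have "{l. l < Suc n \<and> (x(n := y)) l \<in> bin tau js i}
      = (if i = j then insert n {l. l < n \<and> x l \<in> bin tau js i} else {l. l < n \<and> x l \<in> bin tau js i})"
    by (auto simp: less_Suc_eq)
  then show ?thesis by (simp add: bincount_def)
qed

text \<open>Seen as a Polya urn, the Dirichlet--multinomial weight is multiplied at each new observation in
  bin \<open>j\<close> by the predictive probability of bin \<open>j\<close>; these predictive probabilities sum to 1.\<close>

lemma nn_integral_dirichlet_multinomial_le_1:
  assumes js: "js \<in> partitions K" and a: "\<And>j. j \<in> {1..nbins js} \<Longrightarrow> a j > 0"
    and M: "prob_space M" "sets M = sets borel" "AE y in M. y \<in> {0..1}"
    and w[measurable]: "w \<in> borel_measurable borel" and w0: "\<And>y. w y \<ge> 0"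
    and w1: "\<And>j. j \<in> {1..nbins js} \<Longrightarrow> (\<integral>\<^sup>+y. ennreal (w y) * indicator (bin tau js j) y \<partial>M) \<le> 1"
  shows "(\<integral>\<^sup>+x. ennreal (dirichlet_multinomial a (nbins js) n (bincount n x tau js) * (\<Prod>i<n. w (x i)))
      \<partial>PiM {..<n} (\<lambda>_. M)) \<le> 1"
proof -
  interpret prob_space M by (rule M)
  interpret P: product_sigma_finite "\<lambda>_::nat. M" ..
  let ?k = "nbins js"
  let ?A = "\<Sum>j=1..?k. a j"
  let ?D = "\<lambda>n x. dirichlet_multinomial a ?k n (bincount n x tau js)"
  have k: "?k \<ge> 1" using partitionsD(1)[OF js] .
  have A: "?A > 0" using a k by (intro sum_pos) auto
  note sM[measurable_cong] = M(2)
  have bin[measurable]: "bin tau js j \<in> sets borel" for j using js by (rule bin_borel)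
  have meas: "(\<lambda>x. ennreal (?D n x * (\<Prod>i<n. w (x i)))) \<in> borel_measurable (PiM {..<n} (\<lambda>_. M))" for n
  proof -
    have [measurable]: "?D n \<in> borel_measurable (PiM {..<n} (\<lambda>_. M))"
      by (rule measurable_dirichlet_multinomial) (rule measurable_bincount[OF bin order_refl sM])
    show ?thesis by measurable
  qed
  show ?thesis
  proof (induction n)
    case 0
    then show ?case by (simp add: dirichlet_multinomial_def bincount_def PiM_empty nn_integral_count_space_finite)
  next
    case (Suc n)
    let ?c = "\<lambda>x. ?D n x * (\<Prod>i<n. w (x i))"
    have c0: "?c x \<ge> 0" for x
      using dirichlet_multinomial_pos[OF k a, where n = n and N = "bincount n x tau js"] w0
      by (intro mult_nonneg_nonneg prod_nonneg) (auto simp: less_imp_le)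
    \<comment> \<open>The supermartingale step: integrating out the newest observation, bin
      \<open>j\<close> contributes its predictive probability \<open>q j\<close> times an integral
      that \<open>w1\<close> bounds by 1. It is shown for every \<open>x\<close>; points off the
      unit interval only make the sum of the \<open>q j\<close> smaller.\<close>
    have inner: "(\<integral>\<^sup>+y. ennreal (?D (Suc n) (x(n := y)) * (\<Prod>i<Suc n. w ((x(n := y)) i))) \<partial>M) \<le> ennreal (?c x)" for x
    proof -
      define q where "q = (\<lambda>j. (a j + real (bincount n x tau js j)) / (?A + real n))"
      have q0: "q j \<ge> 0" if "j \<in> {1..?k}" for j using a[OF that] A by (auto simp: q_def)
      have "?D (Suc n) (x(n := y)) * (\<Prod>i<Suc n. w ((x(n := y)) i))
          = ?c x * (\<Sum>j=1..?k. (q j * w y) * indicator (bin tau js j) y)" if y: "y \<in> {0..1}" for y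
      proof -
        obtain j where j: "j \<in> {1..?k}" "y \<in> bin tau js j" using bin_unique[OF js y] by blast
        have "?D (Suc n) (x(n := y)) = dirichlet_multinomial a ?k (Suc n)
            ((bincount n x tau js)(j := Suc (bincount n x tau js j)))"
          unfolding dirichlet_multinomial_def
          by (intro arg_cong2[of _ _ _ _ "(/)"] prod.cong refl) (subst bincount_Suc_upd[OF js j], auto)
        also have "\<dots> = ?D n x * q j" unfolding q_def by (rule dirichlet_multinomial_step[OF j(1) a])
        finally have 1: "?D (Suc n) (x(n := y)) = ?D n x * q j" .
        have 2: "(\<Prod>i<Suc n. w ((x(n := y)) i)) = (\<Prod>i<n. w (x i)) * w y" by simp
        show ?thesis unfolding 1 2 sum_bin_indicator[OF js j] by simp
      qed
      then have "(\<integral>\<^sup>+y. ennreal (?D (Suc n) (x(n := y)) * (\<Prod>i<Suc n. w ((x(n := y)) i))) \<partial>M)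
          = (\<integral>\<^sup>+y. ennreal (?c x * (\<Sum>j=1..?k. (q j * w y) * indicator (bin tau js j) y)) \<partial>M)"
        by (intro nn_integral_cong_AE eventually_mono[OF M(3)] arg_cong[where f = ennreal])
      also have "\<dots> = (\<integral>\<^sup>+y. ennreal (?c x) * (\<Sum>j=1..?k. ennreal (q j) * (ennreal (w y) * indicator (bin tau js j) y)) \<partial>M)"
      proof (rule nn_integral_cong)
        fix y
        have "ennreal (\<Sum>j=1..?k. (q j * w y) * indicator (bin tau js j) y)
            = (\<Sum>j=1..?k. ennreal (q j) * (ennreal (w y) * indicator (bin tau js j) y))"
        proof (subst sum_ennreal[symmetric])
          have qw: "q j * w y \<ge> 0" if "j \<in> {1..?k}" for j
            using q0[OF that] w0[of y] by (rule mult_nonneg_nonneg)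
          show "0 \<le> (q j * w y) * indicator (bin tau js j) y" if "j \<in> {1..?k}" for j
            using qw[OF that] by (rule mult_nonneg_nonneg) simp
          show "(\<Sum>j=1..?k. ennreal ((q j * w y) * indicator (bin tau js j) y))
            = (\<Sum>j=1..?k. ennreal (q j) * (ennreal (w y) * indicator (bin tau js j) y))"
            by (rule sum.cong[OF refl]) (metis (no_types, lifting) q0 qw w0 ennreal_mult ennreal_indicator
                indicator_pos_le mult.assoc)
        qed
        then show "ennreal (?c x * (\<Sum>j=1..?k. (q j * w y) * indicator (bin tau js j) y))
          = ennreal (?c x) * (\<Sum>j=1..?k. ennreal (q j) * (ennreal (w y) * indicator (bin tau js j) y))"
          using c0[of x] q0 w0 by (subst ennreal_mult) (auto intro!: sum_nonneg)
      qed
      also have "\<dots> = ennreal (?c x) * (\<Sum>j=1..?k. ennreal (q j) * (\<integral>\<^sup>+y. ennreal (w y) * indicator (bin tau js j) y \<partial>M))"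
        by (simp add: nn_integral_cmult nn_integral_sum)
      also have "\<dots> \<le> ennreal (?c x) * (\<Sum>j=1..?k. ennreal (q j) * 1)"
        using w1 by (intro mult_left_mono sum_mono) auto
      also have "(\<Sum>j=1..?k. ennreal (q j) * 1) = ennreal (\<Sum>j=1..?k. q j)"
        unfolding mult_1_right using q0 by (rule sum_ennreal)
      also have "(\<Sum>j=1..?k. q j) \<le> 1"
      proof -
        have "real (\<Sum>j=1..?k. bincount n x tau js j) \<le> real n"
          using sum_bincount_le[OF js] by (rule of_nat_mono)
        then show ?thesis using A
          by (simp add: q_def sum_divide_distrib[symmetric] sum.distrib divide_le_eq)
      qed
      then have "ennreal (?c x) * ennreal (\<Sum>j=1..?k. q j) \<le> ennreal (?c x) * 1"
        by (intro mult_left_mono) auto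
      finally show ?thesis unfolding mult_1_right .
    qed
    have "(\<integral>\<^sup>+x. ennreal (?D (Suc n) x * (\<Prod>i<Suc n. w (x i))) \<partial>PiM {..<Suc n} (\<lambda>_. M))
       = (\<integral>\<^sup>+x. (\<integral>\<^sup>+y. ennreal (?D (Suc n) (x(n := y)) * (\<Prod>i<Suc n. w ((x(n := y)) i))) \<partial>M) \<partial>PiM {..<n} (\<lambda>_. M))"
      using meas[of "Suc n"] unfolding lessThan_Suc by (intro P.product_nn_integral_insert) auto
    also have "\<dots> \<le> (\<integral>\<^sup>+x. ennreal (?c x) \<partial>PiM {..<n} (\<lambda>_. M))"
      by (intro nn_integral_mono inner)
    also have "\<dots> \<le> 1" by (rule Suc)
    finally show ?case .
  qed
qed

end

section \<open>Stirling-type bounds and the maximised likelihood\<close>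

lemma fact_ge_power_exp: "real n ^ n * exp (- real n) \<le> fact n"
proof -
  have s: "(\<lambda>m. real n ^ m /\<^sub>R fact m) sums exp (real n)" by (rule exp_converges)
  have "(\<Sum>m\<in>{n}. real n ^ m /\<^sub>R fact m) \<le> (\<Sum>m. real n ^ m /\<^sub>R fact m)"
    by (rule sum_le_suminf) (use s in \<open>auto simp: sums_iff\<close>)
  then have "real n ^ n / fact n \<le> exp (real n)" using s by (simp add: sums_iff divide_inverse mult.commute)
  then have "real n ^ n \<le> exp (real n) * fact n" by (simp add: divide_le_eq)
  then show ?thesis by (simp add: exp_minus divide_simps mult.commute)
qed

text \<open>A crude Stirling bound is enough, because a factor polynomial in \<open>n\<close> per
  partition is absorbed in \<open>exp (C * k * log n)\<close>. The induction step rests on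
  \<open>(1 + 1 / n) ^ (n + 1)\<close> being at least \<open>exp 1\<close>.\<close>

lemma fact_le_power_exp: "n \<ge> 1 \<Longrightarrow> fact n \<le> exp 1 * real n * real n ^ n * exp (- real n)"
proof (induction n rule: dec_induct)
  case base
  then show ?case by (simp flip: exp_add)
next
  case (step n)
  have n: "real n \<ge> 1" using step by simp
  have "exp 1 * real n ^ Suc n \<le> real (Suc n) ^ Suc n"
  proof -
    have "1 / real (Suc n) \<le> - ln (1 - 1 / real (Suc n))"
      using ln_le_minus_one[of "1 - 1 / real (Suc n)"] n by simp
    also have "- ln (1 - 1 / real (Suc n)) = ln (real (Suc n) / real n)"
      using n by (simp add: ln_div diff_divide_eq_iff)
    finally have "1 \<le> real (Suc n) * ln (real (Suc n) / real n)"
      using n by (simp add: divide_le_eq mult.commute)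
    then have "exp 1 \<le> exp (real (Suc n) * ln (real (Suc n) / real n))" by simp
    also have "\<dots> = (real (Suc n) / real n) ^ Suc n"
      using n by (subst exp_of_nat_mult) simp
    finally show ?thesis using n by (simp add: power_divide pos_le_divide_eq)
  qed
  then have "exp 1 * real n ^ Suc n * exp (- real (Suc n)) \<le> real (Suc n) ^ Suc n * exp (- real (Suc n))"
    by (rule mult_right_mono) simp
  moreover have "exp (- real n) = exp 1 * exp (- real (Suc n))" by (simp flip: exp_add)
  ultimately have "real n ^ Suc n * exp (- real n) \<le> real (Suc n) ^ Suc n * exp (- real (Suc n))"
    by (simp only: mult_ac)
  then have "exp 1 * real (Suc n) * (real n ^ Suc n * exp (- real n))
      \<le> exp 1 * real (Suc n) * (real (Suc n) ^ Suc n * exp (- real (Suc n)))"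
    by (intro mult_left_mono) auto
  moreover have "fact (Suc n) \<le> real (Suc n) * (exp 1 * real n * real n ^ n * exp (- real n))"
    using step.IH by (simp only: fact_Suc of_nat_mult of_nat_fact) (intro mult_left_mono, auto)
  moreover have "real (Suc n) * (exp 1 * real n * real n ^ n * exp (- real n))
      = exp 1 * real (Suc n) * (real n ^ Suc n * exp (- real n))"
    by (simp only: power_Suc mult_ac)
  ultimately have "fact (Suc n) \<le> exp 1 * real (Suc n) * (real (Suc n) ^ Suc n * exp (- real (Suc n)))"
    by linarith
  then show ?case by (simp only: mult.assoc)
qed

text \<open>Dirichlet parameters may be as small as a multiple of \<open>1 / k\<close>. Only the
  first factor of the rising factorial suffers: the others dominate those of
  \<open>fact (N - 1)\<close>, and passing from there to \<open>fact N\<close> costs at most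
  \<open>n\<close>.\<close>

lemma pochhammer_lower:
  fixes a b :: real
  assumes "0 < b" "b \<le> 1" "b \<le> a" "N \<le> n" "n \<ge> 1"
  shows "b / real n * fact N \<le> pochhammer a N"
proof (cases N)
  case 0
  then show ?thesis using assms by (simp add: divide_le_eq)
next
  case (Suc M)
  have "fact M = pochhammer (1::real) M" by (simp add: pochhammer_fact)
  also have "\<dots> \<le> pochhammer (a + 1) M"
    unfolding pochhammer_prod using assms by (intro prod_mono) auto
  finally have "b * fact M \<le> a * pochhammer (a + 1) M"
    using assms by (intro mult_mono) auto
  then have "b * fact M \<le> pochhammer a N" by (simp add: Suc pochhammer_rec)
  moreover have "b / real n * fact N \<le> b * fact M"
  proof -
    have "real N * (b * fact M) \<le> real n * (b * fact M)"
      using assms by (intro mult_right_mono) auto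
    then show ?thesis using assms by (simp add: Suc field_simps)
  qed
  ultimately show ?thesis by linarith
qed

text \<open>The factor \<open>A + i\<close> is at most \<open>(i + 1) * exp (A / (i + 1))\<close>,
  and the exponents add up to \<open>A\<close> times a harmonic number, at most
  \<open>1 + ln n\<close>.\<close>

lemma pochhammer_upper:
  fixes A :: real
  assumes "A \<ge> 0" "n \<ge> 1"
  shows "pochhammer A n \<le> fact n * exp (A * (1 + ln (real n)))"
proof -
  have "pochhammer A n \<le> fact n * exp (A * harm n)"
  proof (induction n)
    case (Suc n)
    have "A + real n \<le> real (Suc n) * (1 + A / real (Suc n))" by (simp add: field_simps)
    also have "\<dots> \<le> real (Suc n) * exp (A / real (Suc n))"
      by (intro mult_left_mono exp_ge_add_one_self) auto
    finally have "pochhammer A n * (A + real n)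
        \<le> (fact n * exp (A * harm n)) * (real (Suc n) * exp (A / real (Suc n)))"
      using Suc assms by (intro mult_mono pochhammer_nonneg) auto
    also have "\<dots> = fact (Suc n) * exp (A * harm (Suc n))"
      by (simp add: harm_Suc distrib_left exp_add divide_inverse)
    finally show ?case by (simp add: pochhammer_Suc)
  qed (simp add: harm_def)
  also have "A * harm n \<le> A * (1 + ln (real n))"
    using euler_mascheroni_sequence_decreasing[of 1 n] assms
    by (intro mult_left_mono) (auto simp: harm_expand)
  then have "fact n * exp (A * harm n) \<le> fact n * exp (A * (1 + ln (real n)))" by simp
  finally show ?thesis .
qed

text \<open>Integrating over the parameters loses only a polynomial factor per bin against
  maximising over them. The exponentials from Stirling's bounds for the bins and for the total
  cancel since the counts sum to \<open>n\<close>, which leaves the maximised multinomial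
  likelihood; an empty bin enters it as \<open>0 ^ 0 = 1\<close>.\<close>

lemma dirichlet_multinomial_lower:
  fixes a :: "nat \<Rightarrow> real"
  assumes k: "k \<ge> 1" and n: "n \<ge> 1" and N: "(\<Sum>j=1..k. N j) = n"
    and b: "0 < b" "b \<le> 1" and a: "\<And>j. j \<in> {1..k} \<Longrightarrow> b \<le> a j \<and> a j \<le> s"
  shows "(b / real n) ^ k * exp (- (1 + ln (real n) + s * real k * (1 + ln (real n))))
      * (\<Prod>j=1..k. (real (N j) / real n) ^ N j) \<le> dirichlet_multinomial a k n N"
proof -
  let ?A = "\<Sum>j=1..k. a j"
  let ?E = "exp (s * real k * (1 + ln (real n)))"
  have Nle: "N j \<le> n" if "j \<in> {1..k}" for j
    using N member_le_sum[of j "{1..k}" N] that by auto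
  have A0: "?A > 0" using a b k by (intro sum_pos) (auto intro: less_le_trans)
  have "?A \<le> real k * s" using sum_bounded_above[of "{1..k}" a s] a by simp
  then have As: "?A * (1 + ln (real n)) \<le> s * real k * (1 + ln (real n))"
    using n by (intro mult_right_mono) (auto simp: mult.commute)
  have num: "(b / real n) ^ k * (\<Prod>j=1..k. real (N j) ^ N j) * exp (- real n) \<le> (\<Prod>j=1..k. pochhammer (a j) (N j))"
  proof -
    have "(b / real n) ^ k * (\<Prod>j=1..k. real (N j) ^ N j) * exp (- real n)
        = (\<Prod>j=1..k. b / real n * (real (N j) ^ N j * exp (- real (N j))))"
    proof -
      have "exp (- real n) = (\<Prod>j=1..k. exp (- real (N j)))"
        by (simp add: exp_sum[symmetric] sum_negf flip: N)
      then show ?thesis by (simp only: prod.distrib prod_constant card_atLeastAtMost) simp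
    qed
    also have "\<dots> \<le> (\<Prod>j=1..k. pochhammer (a j) (N j))"
    proof (rule prod_mono)
      fix j assume j: "j \<in> {1..k}"
      have "b / real n * (real (N j) ^ N j * exp (- real (N j))) \<le> b / real n * fact (N j)"
        using b by (intro mult_left_mono fact_ge_power_exp) auto
      also have "\<dots> \<le> pochhammer (a j) (N j)"
        using a[OF j] b Nle[OF j] n by (intro pochhammer_lower) auto
      finally show "0 \<le> b / real n * (real (N j) ^ N j * exp (- real (N j)))
          \<and> b / real n * (real (N j) ^ N j * exp (- real (N j))) \<le> pochhammer (a j) (N j)"
        using b by auto
    qed
    finally show ?thesis .
  qed
  have den: "pochhammer ?A n \<le> exp 1 * real n * real n ^ n * exp (- real n) * ?E"
  proof -
    have "pochhammer ?A n \<le> fact n * exp (?A * (1 + ln (real n)))"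
      using A0 n by (intro pochhammer_upper) auto
    also have "\<dots> \<le> (exp 1 * real n * real n ^ n * exp (- real n)) * ?E"
      using As fact_le_power_exp[OF n] by (intro mult_mono) auto
    finally show ?thesis .
  qed
  have "(b / real n) ^ k * exp (- (1 + ln (real n) + s * real k * (1 + ln (real n))))
      * (\<Prod>j=1..k. (real (N j) / real n) ^ N j)
    = ((b / real n) ^ k * (\<Prod>j=1..k. real (N j) ^ N j) * exp (- real n))
       / (exp 1 * real n * real n ^ n * exp (- real n) * ?E)"
  proof -
    have "exp (- (1 + ln (real n) + s * real k * (1 + ln (real n)))) = 1 / (exp 1 * real n * ?E)"
    proof -
      have "exp (1 + ln (real n) + s * real k * (1 + ln (real n))) = exp 1 * real n * ?E"
        using n by (simp only: exp_add) simp
      then show ?thesis by (simp only: exp_minus inverse_eq_divide)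
    qed
    moreover have "(\<Prod>j=1..k. (real (N j) / real n) ^ N j) = (\<Prod>j=1..k. real (N j) ^ N j) / real n ^ n"
      unfolding power_divide prod_dividef by (simp only: power_sum[symmetric] N)
    ultimately show ?thesis by simp
  qed
  also have "\<dots> \<le> (\<Prod>j=1..k. pochhammer (a j) (N j)) / pochhammer ?A n"
  proof (rule frac_le)
    have "a j > 0" if "j \<in> {1..k}" for j using a[OF that] b by auto
    then show "0 \<le> (\<Prod>j=1..k. pochhammer (a j) (N j))"
      by (intro prod_nonneg pochhammer_nonneg) auto
    show "0 < pochhammer ?A n" using A0 by (rule pochhammer_pos)
  qed (use num den in auto)
  finally show ?thesis by (simp add: dirichlet_multinomial_def)
qed

text \<open>Uses \<open>s \<le> exp (s - 1)\<close> at \<open>s = sqrt (\<theta> / q)\<close> with \<open>q = N / n\<close>, so that the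
  Kullback--Leibler divergence of the empirical bin frequencies dominates the squared Hellinger distance.\<close>

lemma empirical_likelihood_ratio:
  fixes \<theta> :: "nat \<Rightarrow> real"
  assumes n: "n \<ge> 1" and N: "(\<Sum>j=1..k. N j) = n"
    and th: "\<And>j. j \<in> {1..k} \<Longrightarrow> \<theta> j \<ge> 0" "(\<Sum>j=1..k. \<theta> j) = 1"
  shows "exp (real n * (\<Sum>j=1..k. (sqrt (real (N j) / real n) - sqrt (\<theta> j))\<^sup>2)) * (\<Prod>j=1..k. \<theta> j ^ N j)
    \<le> (\<Prod>j=1..k. (real (N j) / real n) ^ N j)"
proof -
  let ?q = "\<lambda>j. real (N j) / real n"
  have sq: "(\<Sum>j=1..k. ?q j) = 1"
    using N n by (simp add: sum_divide_distrib[symmetric] flip: of_nat_sum)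
  have "(\<Sum>j=1..k. (sqrt (?q j) - sqrt (\<theta> j))\<^sup>2) = (\<Sum>j=1..k. ?q j + \<theta> j - 2 * sqrt (\<theta> j * ?q j))"
    using th(1) by (intro sum.cong refl) (simp add: power2_diff real_sqrt_mult[symmetric] mult_ac)
  \<comment> \<open>Both vectors sum to 1, so \<open>\<theta> j\<close> can be traded for
    \<open>?q j\<close>. Each term then carries a factor proportional to \<open>N j\<close>, and the
    claim can be proved bin by bin.\<close>
  also have "\<dots> = (\<Sum>j=1..k. 2 * (?q j - sqrt (\<theta> j * ?q j)))"
    using sq th(2) by (simp only: sum.distrib sum_subtractf sum_distrib_left[symmetric] right_diff_distrib)
  finally have "exp (real n * (\<Sum>j=1..k. (sqrt (?q j) - sqrt (\<theta> j))\<^sup>2))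
      = (\<Prod>j=1..k. exp (real n * (2 * (?q j - sqrt (\<theta> j * ?q j)))))"
    by (simp add: sum_distrib_left exp_sum)
  then have "exp (real n * (\<Sum>j=1..k. (sqrt (?q j) - sqrt (\<theta> j))\<^sup>2)) * (\<Prod>j=1..k. \<theta> j ^ N j)
      = (\<Prod>j=1..k. exp (real n * (2 * (?q j - sqrt (\<theta> j * ?q j)))) * \<theta> j ^ N j)"
    by (simp add: prod.distrib)
  also have "\<dots> \<le> (\<Prod>j=1..k. ?q j ^ N j)"
  proof (rule prod_mono)
    fix j assume j: "j \<in> {1..k}"
    have "exp (real n * (2 * (?q j - sqrt (\<theta> j * ?q j)))) * \<theta> j ^ N j \<le> ?q j ^ N j"
    proof (cases "N j = 0")
      case False
      then have q: "?q j > 0" using n by simp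
      define s where "s = sqrt (\<theta> j / ?q j)"
      have s0: "s \<ge> 0" using q th(1)[OF j] by (simp add: s_def)
      have "s\<^sup>2 = \<theta> j / ?q j" unfolding s_def using th(1)[OF j] q by (intro real_sqrt_pow2) auto
      then have th_s: "\<theta> j = s\<^sup>2 * ?q j" using q by (metis less_irrefl nonzero_divide_eq_eq)
      have "sqrt (\<theta> j * ?q j) = s * ?q j"
        using q s0 unfolding th_s
        by (intro real_sqrt_unique) (auto simp: power2_eq_square mult_ac)
      then have e: "real n * (2 * (?q j - sqrt (\<theta> j * ?q j))) = real (2 * N j) * (1 - s)"
        using n by (simp add: field_simps)
      have "s \<le> exp (s - 1)" using exp_ge_add_one_self[of "s - 1"] by simp
      then have "s ^ (2 * N j) \<le> exp (s - 1) ^ (2 * N j)" using s0 by (rule power_mono)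
      also have "\<dots> = exp (real (2 * N j) * (s - 1))" by (rule exp_of_nat_mult[symmetric])
      finally have "exp (real (2 * N j) * (1 - s)) * s ^ (2 * N j)
          \<le> exp (real (2 * N j) * (1 - s)) * exp (real (2 * N j) * (s - 1))" by (intro mult_left_mono) auto
      also have "\<dots> = 1" by (simp flip: exp_add add: algebra_simps)
      finally have "exp (real (2 * N j) * (1 - s)) * s ^ (2 * N j) \<le> 1" .
      then have "exp (real (2 * N j) * (1 - s)) * s ^ (2 * N j) * ?q j ^ N j \<le> 1 * ?q j ^ N j"
        using q by (intro mult_right_mono) auto
      moreover have "\<theta> j ^ N j = s ^ (2 * N j) * ?q j ^ N j"
        unfolding th_s power_mult_distrib power_mult ..
      ultimately show ?thesis unfolding e by (simp only: mult.assoc mult_1_left)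
    qed simp
    then show "0 \<le> exp (real n * (2 * (?q j - sqrt (\<theta> j * ?q j)))) * \<theta> j ^ N j \<and>
        exp (real n * (2 * (?q j - sqrt (\<theta> j * ?q j)))) * \<theta> j ^ N j \<le> ?q j ^ N j"
      using th(1)[OF j] by auto
  qed
  finally show ?thesis .
qed

section \<open>Hellinger distance and histogram densities\<close>

lemma hellinger_facts:
  fixes f g :: "real \<Rightarrow> real"
  assumes [measurable]: "f \<in> borel_measurable borel" "g \<in> borel_measurable borel"
    and f: "\<And>t. t \<in> {0..1} \<Longrightarrow> 0 \<le> f t" "set_integrable lborel {0..1} f"
    and g: "\<And>t. t \<in> {0..1} \<Longrightarrow> 0 \<le> g t" "set_integrable lborel {0..1} g"
  shows set_integrable_hellinger: "set_integrable lborel {0..1} (\<lambda>t. (sqrt (f t) - sqrt (g t))\<^sup>2)"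
    and set_integrable_sqrt_mult: "set_integrable lborel {0..1} (\<lambda>t. sqrt (f t * g t))"
    and hellinger_sq_eq: "hellinger_sq f g = (LINT t:{0..1}|lborel. f t) + (LINT t:{0..1}|lborel. g t)
      - 2 * (LINT t:{0..1}|lborel. sqrt (f t * g t))"
    and hellinger_sq_le: "hellinger_sq f g \<le> (LINT t:{0..1}|lborel. f t) + (LINT t:{0..1}|lborel. g t)"
proof -
  have sum: "set_integrable lborel {0..1} (\<lambda>t. f t + g t)" using f g by (intro set_integral_add)
  show s: "set_integrable lborel {0..1} (\<lambda>t. sqrt (f t * g t))"
  proof (rule set_integrable_bound[OF sum])
    show "AE t in lborel. t \<in> {0..1} \<longrightarrow> norm (sqrt (f t * g t)) \<le> norm (f t + g t)"
    proof (intro AE_I2 impI)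
      fix t :: real assume t: "t \<in> {0..1}"
      have "sqrt (f t * g t) \<le> (f t + g t) / 2" using f(1)[OF t] g(1)[OF t] by (rule arith_geo_mean_sqrt)
      then show "norm (sqrt (f t * g t)) \<le> norm (f t + g t)" using f(1)[OF t] g(1)[OF t] by simp
    qed
  qed (simp add: set_borel_measurable_def)
  have eq: "(sqrt (f t) - sqrt (g t))\<^sup>2 = f t + g t - 2 * sqrt (f t * g t)" if "t \<in> {0..1}" for t
    using f(1)[OF that] g(1)[OF that] by (simp add: power2_diff real_sqrt_mult)
  have i: "set_integrable lborel {0..1} (\<lambda>t. f t + g t - 2 * sqrt (f t * g t))"
    using sum s by (intro set_integral_diff set_integrable_mult_right)
  then show h: "set_integrable lborel {0..1} (\<lambda>t. (sqrt (f t) - sqrt (g t))\<^sup>2)"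
    by (subst set_integrable_cong[OF refl refl eq]) auto
  have "hellinger_sq f g = (LINT t:{0..1}|lborel. f t + g t - 2 * sqrt (f t * g t))"
    unfolding hellinger_sq_def using eq by (intro set_lebesgue_integral_cong) auto
  also have "\<dots> = (LINT t:{0..1}|lborel. f t) + (LINT t:{0..1}|lborel. g t)
      - 2 * (LINT t:{0..1}|lborel. sqrt (f t * g t))"
    using sum s f g by (subst set_integral_diff) (auto simp: set_integral_add)
  finally show *: "hellinger_sq f g = (LINT t:{0..1}|lborel. f t) + (LINT t:{0..1}|lborel. g t)
      - 2 * (LINT t:{0..1}|lborel. sqrt (f t * g t))" .
  have "(LINT t:{0..1}|lborel. sqrt (f t * g t)) \<ge> 0"
    unfolding set_lebesgue_integral_def
    by (rule integral_nonneg_AE) (use f(1) g(1) in \<open>auto simp: indicator_def\<close>)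
  with * show "hellinger_sq f g \<le> (LINT t:{0..1}|lborel. f t) + (LINT t:{0..1}|lborel. g t)" by simp
qed

lemma hellinger_sq_triangle:
  fixes f g h :: "real \<Rightarrow> real"
  assumes "f \<in> borel_measurable borel" "g \<in> borel_measurable borel" "h \<in> borel_measurable borel"
    and f: "\<And>t. t \<in> {0..1} \<Longrightarrow> 0 \<le> f t" "set_integrable lborel {0..1} f"
    and g: "\<And>t. t \<in> {0..1} \<Longrightarrow> 0 \<le> g t" "set_integrable lborel {0..1} g"
    and h: "\<And>t. t \<in> {0..1} \<Longrightarrow> 0 \<le> h t" "set_integrable lborel {0..1} h"
  shows "hellinger_sq f h \<le> 2 * hellinger_sq f g + 2 * hellinger_sq g h"
proof -
  note i = set_integrable_hellinger[OF assms(1,2) f g] set_integrable_hellinger[OF assms(2,3) g h]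
    set_integrable_hellinger[OF assms(1,3) f h]
  have "hellinger_sq f h \<le> (LINT t:{0..1}|lborel. 2 * (sqrt (f t) - sqrt (g t))\<^sup>2 + 2 * (sqrt (g t) - sqrt (h t))\<^sup>2)"
    unfolding hellinger_sq_def
  proof (rule set_integral_mono)
    fix t :: real assume "t \<in> {0..1}"
    have "(a - c)\<^sup>2 \<le> 2 * (a - b)\<^sup>2 + 2 * (b - c)\<^sup>2" for a b c :: real
      using zero_le_power2[of "(a - b) - (b - c)"] by (simp add: power2_eq_square algebra_simps)
    then show "(sqrt (f t) - sqrt (h t))\<^sup>2 \<le> 2 * (sqrt (f t) - sqrt (g t))\<^sup>2 + 2 * (sqrt (g t) - sqrt (h t))\<^sup>2" .
  qed (use i in \<open>auto intro!: set_integral_add set_integrable_mult_right\<close>)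
  also have "\<dots> = 2 * hellinger_sq f g + 2 * hellinger_sq g h"
    unfolding hellinger_sq_def using i by (subst set_integral_add) auto
  finally show ?thesis .
qed

context grid
begin

text \<open>Parametrised by bin masses instead of heights: the integral is the sum of the masses,
  and between two histograms on the same partition the Hellinger distance is that of the mass
  vectors.\<close>

definition step :: "nat list \<Rightarrow> (nat \<Rightarrow> real) \<Rightarrow> real \<Rightarrow> real" where
  "step js c t = (\<Sum>j=1..nbins js. c j / binlen tau js j * indicator (bin tau js j) t)"

lemma hist_est_eq_step:
  "hist_est n a tau x js = step js (\<lambda>j. (a j + real (bincount n x tau js j)) / ((\<Sum>j=1..nbins js. a j) + real n))"
  by (simp add: fun_eq_iff hist_est_def step_def Let_def)

context
  fixes js assumes js: "js \<in> partitions K"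
begin

lemma step_eq: "j \<in> {1..nbins js} \<Longrightarrow> t \<in> bin tau js j \<Longrightarrow> step js c t = c j / binlen tau js j"
  unfolding step_def by (rule sum_bin_indicator[OF js])

lemma step_borel[measurable]: "step js c \<in> borel_measurable borel"
  using bin_borel[OF js] unfolding step_def[abs_def] by measurable

lemma step_nonneg:
  assumes "\<And>j. j \<in> {1..nbins js} \<Longrightarrow> c j \<ge> 0"
  shows "step js c t \<ge> 0"
  unfolding step_def using assms binlen_pos[OF js]
  by (intro sum_nonneg mult_nonneg_nonneg divide_nonneg_nonneg) (auto intro: less_imp_le)

lemma has_integral_step:
  "has_bochner_integral lborel (\<lambda>t. indicator {0..1} t *\<^sub>R step js c t) (\<Sum>j=1..nbins js. c j)"
proof -
  have e: "indicator {0..1} t *\<^sub>R step js c t = (\<Sum>j=1..nbins js. c j / binlen tau js j * indicator (bin tau js j) t)" for t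
    unfolding step_def real_scaleR_def sum_distrib_left
    using bin_subset[OF js] by (intro sum.cong refl) (auto simp: indicator_def simp del: atLeastAtMost_iff dest: subsetD)
  have "has_bochner_integral lborel (\<lambda>t. \<Sum>j=1..nbins js. c j / binlen tau js j * indicator (bin tau js j) t)
      (\<Sum>j=1..nbins js. c j)"
  proof (rule has_bochner_integral_sum)
    fix j assume j: "j \<in> {1..nbins js}"
    have "has_bochner_integral lborel (indicator (bin tau js j)) (measure lborel (bin tau js j))"
      using bin_borel[OF js] bin_lborel[OF js j] by (intro has_bochner_integral_real_indicator) auto
    moreover have "measure lborel (bin tau js j) = binlen tau js j"
      using bin_lborel[OF js j] binlen_pos[OF js j] by (simp add: measure_def)
    ultimately show "has_bochner_integral lborel (\<lambda>t. c j / binlen tau js j * indicator (bin tau js j) t) (c j)"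
      using has_bochner_integral_mult_right[of "c j / binlen tau js j" lborel "indicator (bin tau js j)" "binlen tau js j"]
        binlen_pos[OF js j] by simp
  qed
  then show ?thesis by (simp only: e)
qed

lemma set_integrable_step: "set_integrable lborel {0..1} (step js c)"
  and integral_step: "(LINT t:{0..1}|lborel. step js c t) = (\<Sum>j=1..nbins js. c j)"
  using has_integral_step[of c]
  by (auto simp: set_integrable_def set_lebesgue_integral_def has_bochner_integral_iff)

lemma hellinger_sq_step:
  assumes "\<And>j. j \<in> {1..nbins js} \<Longrightarrow> c j \<ge> 0" "\<And>j. j \<in> {1..nbins js} \<Longrightarrow> d j \<ge> 0"
  shows "hellinger_sq (step js c) (step js d) = (\<Sum>j=1..nbins js. (sqrt (c j) - sqrt (d j))\<^sup>2)"
proof -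
  have "hellinger_sq (step js c) (step js d) = (LINT t:{0..1}|lborel. step js (\<lambda>j. (sqrt (c j) - sqrt (d j))\<^sup>2) t)"
    unfolding hellinger_sq_def
  proof (rule set_lebesgue_integral_cong)
    show "\<forall>t. t \<in> {0..1} \<longrightarrow> (sqrt (step js c t) - sqrt (step js d t))\<^sup>2 = step js (\<lambda>j. (sqrt (c j) - sqrt (d j))\<^sup>2) t"
    proof (intro allI impI)
      fix t :: real assume "t \<in> {0..1}"
      then obtain j where j: "j \<in> {1..nbins js}" "t \<in> bin tau js j" using bin_unique[OF js] by blast
      have "(sqrt (c j / l) - sqrt (d j / l))\<^sup>2 = (sqrt (c j) - sqrt (d j))\<^sup>2 / l" if "l > 0" for l
      proof -
        have "sqrt (c j / l) - sqrt (d j / l) = (sqrt (c j) - sqrt (d j)) / sqrt l"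
          by (simp add: real_sqrt_divide diff_divide_distrib)
        then show ?thesis using that by (simp add: power_divide)
      qed
      then show "(sqrt (step js c t) - sqrt (step js d t))\<^sup>2 = step js (\<lambda>j. (sqrt (c j) - sqrt (d j))\<^sup>2) t"
        using binlen_pos[OF js j(1)] by (simp add: step_eq[OF j])
    qed
  qed simp
  then show ?thesis by (simp add: integral_step)
qed

end

end

section \<open>The true density, its projections and expected likelihood ratios\<close>

text \<open>The lower bound is required on the whole line, so quotients by \<open>f\<close> are safe
  at every point. The given density is later extended beyond the unit interval by its boundary
  values to fit.\<close>

locale hist_density = grid +
  fixes f :: "real \<Rightarrow> real" and c :: real
  assumes f_borel[measurable]: "f \<in> borel_measurable borel"
    and c_pos: "c > 0" and f_ge: "\<And>t. f t \<ge> c"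
    and f_int: "set_integrable lborel {0..1} f" and f_one: "(LINT t:{0..1}|lborel. f t) = 1"
begin

lemma f_pos: "f t > 0" using c_pos f_ge[of t] by simp

lemma sets_obs[measurable_cong, simp]: "sets (obs_measure f) = sets borel"
  by (simp add: obs_measure_def)

lemma nn_integral_obs:
  assumes [measurable]: "g \<in> borel_measurable borel"
  shows "(\<integral>\<^sup>+t. g t \<partial>obs_measure f) = (\<integral>\<^sup>+t. ennreal (f t) * g t * indicator {0..1} t \<partial>lborel)"
  unfolding obs_measure_def by (subst nn_integral_density) (auto simp: mult_ac)

lemma nn_integral_unit_interval:
  assumes "\<And>t. t \<in> {0..1} \<Longrightarrow> g t \<ge> 0" "set_integrable lborel {0..1} g"
  shows "(\<integral>\<^sup>+t. ennreal (g t) * indicator {0..1} t \<partial>lborel) = ennreal (LINT t:{0..1}|lborel. g t)"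
proof -
  have "(\<integral>\<^sup>+t. ennreal (g t) * indicator {0..1} t \<partial>lborel) = (\<integral>\<^sup>+t. ennreal (indicator {0..1} t *\<^sub>R g t) \<partial>lborel)"
    by (intro nn_integral_cong) (auto simp: indicator_def)
  also have "\<dots> = ennreal (LINT t:{0..1}|lborel. g t)"
    unfolding set_lebesgue_integral_def
    using assms by (intro nn_integral_eq_integral) (auto simp: set_integrable_def indicator_def)
  finally show ?thesis .
qed

sublocale M: prob_space "obs_measure f"
proof
  have "emeasure (obs_measure f) (space (obs_measure f)) = (\<integral>\<^sup>+t. 1 \<partial>obs_measure f)" by simp
  also have "\<dots> = 1"
    using nn_integral_unit_interval[of f] f_pos f_int f_one
    by (subst nn_integral_obs) (auto intro: less_imp_le)
  finally show "emeasure (obs_measure f) (space (obs_measure f)) = 1" .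
qed

sublocale P: product_sigma_finite "\<lambda>_::nat. obs_measure f" ..

lemma AE_obs: "AE t in obs_measure f. t \<in> {0..1}"
  unfolding obs_measure_def by (subst AE_density) (auto simp: indicator_def)

lemma AE_sample: "AE x in sample_measure f n. \<forall>i<n. x i \<in> {0..1}"
proof -
  have "AE x in sample_measure f n. x i \<in> {0..1}" if "i < n" for i
    unfolding sample_measure_def by (rule AE_PiM_component) (use that AE_obs M.prob_space_axioms in auto)
  then have "AE x in sample_measure f n. \<forall>i\<in>{..<n}. x i \<in> {0..1}"
    by (intro AE_finite_allI) auto
  then show ?thesis by eventually_elim auto
qed

lemma nn_integral_sample_prod:
  assumes [measurable]: "g \<in> borel_measurable borel" and "\<And>t. g t \<ge> 0"
  shows "(\<integral>\<^sup>+x. ennreal (\<Prod>i<n. g (x i)) \<partial>sample_measure f n) = (\<integral>\<^sup>+t. ennreal (f t * g t) * indicator {0..1} t \<partial>lborel) ^ n"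
proof -
  have "(\<integral>\<^sup>+x. ennreal (\<Prod>i<n. g (x i)) \<partial>sample_measure f n) = (\<integral>\<^sup>+x. (\<Prod>i<n. ennreal (g (x i))) \<partial>sample_measure f n)"
    using assms by (simp add: prod_ennreal)
  also have "\<dots> = (\<integral>\<^sup>+t. ennreal (g t) \<partial>obs_measure f) ^ n"
    unfolding sample_measure_def by (subst P.product_nn_integral_prod) auto
  also have "(\<integral>\<^sup>+t. ennreal (g t) \<partial>obs_measure f) = (\<integral>\<^sup>+t. ennreal (f t * g t) * indicator {0..1} t \<partial>lborel)"
    using f_pos assms(2) by (subst nn_integral_obs) (auto simp: ennreal_mult less_imp_le)
  finally show ?thesis .
qed

definition mass :: "nat list \<Rightarrow> nat \<Rightarrow> real" where
  "mass js j = measure (obs_measure f) (bin tau js j)"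

definition proj :: "nat list \<Rightarrow> real \<Rightarrow> real" where
  "proj js = step js (mass js)"

definition marg :: "(nat \<Rightarrow> real) \<Rightarrow> nat \<Rightarrow> nat list \<Rightarrow> (nat \<Rightarrow> real) \<Rightarrow> real" where
  "marg a n js x = dirichlet_multinomial a (nbins js) n (bincount n x tau js)
     / (\<Prod>j=1..nbins js. binlen tau js j ^ bincount n x tau js j)"

context
  fixes js assumes js: "js \<in> partitions K"
begin

lemma mass_eq: "j \<in> {1..nbins js} \<Longrightarrow> ennreal (mass js j) = (\<integral>\<^sup>+t. ennreal (f t) * indicator (bin tau js j) t \<partial>lborel)"
proof -
  assume j: "j \<in> {1..nbins js}"
  have "ennreal (mass js j) = (\<integral>\<^sup>+t. indicator (bin tau js j) t \<partial>obs_measure f)"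
    using bin_borel[OF js] by (simp add: mass_def M.emeasure_eq_measure)
  also have "\<dots> = (\<integral>\<^sup>+t. ennreal (f t) * indicator (bin tau js j) t \<partial>lborel)"
    using bin_borel[OF js] bin_subset[OF js j] by (subst nn_integral_obs) (auto intro!: nn_integral_cong simp: indicator_def)
  finally show ?thesis .
qed

lemma mass_ge: "j \<in> {1..nbins js} \<Longrightarrow> mass js j \<ge> c * binlen tau js j"
proof -
  assume j: "j \<in> {1..nbins js}"
  have "ennreal (c * binlen tau js j) = (\<integral>\<^sup>+t. ennreal c * indicator (bin tau js j) t \<partial>lborel)"
    using bin_borel[OF js] bin_lborel[OF js j] binlen_pos[OF js j] c_pos
    by (simp add: nn_integral_cmult_indicator ennreal_mult less_imp_le)
  also have "\<dots> \<le> ennreal (mass js j)"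
    unfolding mass_eq[OF j] using f_ge by (intro nn_integral_mono mult_right_mono ennreal_leI) auto
  finally show ?thesis by (simp add: mass_def)
qed

lemma mass_pos: "j \<in> {1..nbins js} \<Longrightarrow> mass js j > 0"
  using mass_ge binlen_pos[OF js] c_pos by (metis mult_pos_pos order_less_le_trans)

lemma sum_mass: "(\<Sum>j=1..nbins js. mass js j) = 1"
proof -
  have "(\<Sum>j=1..nbins js. mass js j) = measure (obs_measure f) (\<Union>j\<in>{1..nbins js}. bin tau js j)"
    unfolding mass_def using bin_borel[OF js] bin_disjoint[OF js]
    by (intro M.finite_measure_finite_Union[symmetric]) auto
  also have "\<dots> = 1"
    unfolding bin_cover[OF js] using AE_obs by (subst M.prob_eq_1) auto
  finally show ?thesis .
qed

lemma proj_borel[measurable]: "proj js \<in> borel_measurable borel"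
  unfolding proj_def by (rule step_borel[OF js])

lemma proj_nonneg: "proj js t \<ge> 0"
  unfolding proj_def using mass_pos by (intro step_nonneg[OF js]) (auto intro: less_imp_le)

lemma proj_ge: "t \<in> {0..1} \<Longrightarrow> proj js t \<ge> c"
proof -
  assume "t \<in> {0..1}"
  then obtain j where j: "j \<in> {1..nbins js}" "t \<in> bin tau js j" using bin_unique[OF js] by blast
  show ?thesis
    using mass_ge[OF j(1)] binlen_pos[OF js j(1)] by (simp add: proj_def step_eq[OF js j] le_divide_eq)
qed

lemma set_integrable_proj: "set_integrable lborel {0..1} (proj js)"
  and integral_proj: "(LINT t:{0..1}|lborel. proj js t) = 1"
  unfolding proj_def using set_integrable_step[OF js] integral_step[OF js] sum_mass by auto

end

end

context hist_density
begin

lemma sample_component[measurable]: "i < n \<Longrightarrow> (\<lambda>x. x i) \<in> borel_measurable (sample_measure f n)"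
  unfolding sample_measure_def using measurable_component_singleton[of i "{..<n}" "\<lambda>_. obs_measure f"]
  by (simp add: measurable_cong_sets[OF refl sets_obs])

lemma borel_sample_prod:
  fixes g :: "real \<Rightarrow> real"
  assumes [measurable]: "g \<in> borel_measurable borel"
  shows "(\<lambda>x. \<Prod>i<n. g (x i)) \<in> borel_measurable (sample_measure f n)"
  by (intro borel_measurable_prod measurable_compose[OF sample_component]) auto

lemma marg_borel:
  assumes "js \<in> partitions K"
  shows "marg a n js \<in> borel_measurable (sample_measure f n)"
proof -
  have b[measurable]: "(\<lambda>x. bincount n x tau js j) \<in> measurable (sample_measure f n) (count_space UNIV)" for j
    unfolding sample_measure_def using bin_borel[OF assms] by (intro measurable_bincount) auto
  have [measurable]: "(\<lambda>x. dirichlet_multinomial a (nbins js) n (bincount n x tau js)) \<in> borel_measurable (sample_measure f n)"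
    by (rule measurable_dirichlet_multinomial) (rule b)
  have [measurable]: "(\<lambda>x. binlen tau js j ^ bincount n x tau js j) \<in> borel_measurable (sample_measure f n)" for j
    by (rule measurable_compose[OF b]) simp
  show ?thesis unfolding marg_def[abs_def] by measurable
qed

lemma marg_pos:
  assumes js: "js \<in> partitions K" and a: "\<And>j. j \<in> {1..nbins js} \<Longrightarrow> a j > 0"
  shows "marg a n js x > 0"
  unfolding marg_def using dirichlet_multinomial_pos[OF partitionsD(1)[OF js] a] binlen_pos[OF js]
  by (intro divide_pos_pos prod_pos) auto

text \<open>The urn bound with weight \<open>1 / (binlen tau js j * g y)\<close> for an observation
  \<open>y\<close> in bin \<open>j\<close>. Condition \<open>le\<close> holds with equality in both
  uses: for \<open>g = f\<close> the integrand is the uniform density of the bin, for the projection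
  it is \<open>f\<close> divided by the bin mass.\<close>

lemma nn_integral_marg_ratio_le_1:
  assumes js: "js \<in> partitions K" and a: "\<And>j. j \<in> {1..nbins js} \<Longrightarrow> a j > 0"
    and g[measurable]: "g \<in> borel_measurable borel" and g0: "\<And>t. g t \<ge> 0"
    and le: "\<And>j. j \<in> {1..nbins js} \<Longrightarrow>
      (\<integral>\<^sup>+t. ennreal (f t * (1 / binlen tau js j / g t)) * indicator (bin tau js j) t \<partial>lborel) \<le> 1"
  shows "(\<integral>\<^sup>+x. ennreal (marg a n js x / (\<Prod>i<n. g (x i))) \<partial>sample_measure f n) \<le> 1"
proof -
  let ?w = "\<lambda>t. step js (\<lambda>_. 1) t / g t"
  have st[measurable]: "step js (\<lambda>_. 1) \<in> borel_measurable borel" by (rule step_borel[OF js])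
  have binb[measurable]: "bin tau js j \<in> sets borel" for j by (rule bin_borel[OF js])
  have eq: "marg a n js x / (\<Prod>i<n. g (x i))
      = dirichlet_multinomial a (nbins js) n (bincount n x tau js) * (\<Prod>i<n. ?w (x i))"
    if x: "\<forall>i<n. x i \<in> {0..1}" for x
  proof -
    have "(\<Prod>i<n. step js (\<lambda>_. 1) (x i)) = (\<Prod>j=1..nbins js. (1 / binlen tau js j) ^ bincount n x tau js j)"
      using x step_eq[OF js] by (intro prod_bincount[OF js]) auto
    then have "(\<Prod>i<n. ?w (x i)) = 1 / (\<Prod>j=1..nbins js. binlen tau js j ^ bincount n x tau js j) / (\<Prod>i<n. g (x i))"
      unfolding prod_dividef by (simp add: power_one_over prod_dividef)
    then show ?thesis by (simp add: marg_def)
  qed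
  have "(\<integral>\<^sup>+x. ennreal (marg a n js x / (\<Prod>i<n. g (x i))) \<partial>sample_measure f n)
    = (\<integral>\<^sup>+x. ennreal (dirichlet_multinomial a (nbins js) n (bincount n x tau js) * (\<Prod>i<n. ?w (x i))) \<partial>sample_measure f n)"
    by (intro nn_integral_cong_AE eventually_mono[OF AE_sample] arg_cong[where f = ennreal] eq)
  also have "\<dots> \<le> 1"
    unfolding sample_measure_def
  proof (rule nn_integral_dirichlet_multinomial_le_1[OF js a M.prob_space_axioms sets_obs AE_obs])
    show "?w \<in> borel_measurable borel" by measurable
    show "0 \<le> ?w t" for t using step_nonneg[OF js] g0 by simp
    fix j assume j: "j \<in> {1..nbins js}"
    have "(\<integral>\<^sup>+y. ennreal (?w y) * indicator (bin tau js j) y \<partial>obs_measure f)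
      = (\<integral>\<^sup>+t. ennreal (f t) * (ennreal (?w t) * indicator (bin tau js j) t) * indicator {0..1} t \<partial>lborel)"
      by (subst nn_integral_obs) auto
    also have "\<dots> = (\<integral>\<^sup>+t. ennreal (f t * (1 / binlen tau js j / g t)) * indicator (bin tau js j) t \<partial>lborel)"
    proof (rule nn_integral_cong)
      fix t :: real
      show "ennreal (f t) * (ennreal (?w t) * indicator (bin tau js j) t) * indicator {0..1} t
        = ennreal (f t * (1 / binlen tau js j / g t)) * indicator (bin tau js j) t"
      proof (cases "t \<in> bin tau js j")
        case True
        then have "t \<in> {0..1}" using bin_subset[OF js j] by blast
        moreover have "0 \<le> 1 / binlen tau js j / g t" using binlen_pos[OF js j] g0[of t] by simp
        ultimately show ?thesis using True f_pos[of t]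
          by (simp only: indicator_simps mult_1_right step_eq[OF js j True])
            (intro ennreal_mult[symmetric], auto)
      qed simp
    qed
    also have "\<dots> \<le> 1" using le[OF j] .
    finally show "(\<integral>\<^sup>+y. ennreal (?w y) * indicator (bin tau js j) y \<partial>obs_measure f) \<le> 1" .
  qed auto
  finally show ?thesis .
qed

lemma nn_integral_marg_over_density:
  assumes js: "js \<in> partitions K" and a: "\<And>j. j \<in> {1..nbins js} \<Longrightarrow> a j > 0"
  shows "(\<integral>\<^sup>+x. ennreal (marg a n js x / (\<Prod>i<n. f (x i))) \<partial>sample_measure f n) \<le> 1"
proof (rule nn_integral_marg_ratio_le_1[OF js a f_borel])
  show "f t \<ge> 0" for t using f_pos[of t] by simp
  fix j assume j: "j \<in> {1..nbins js}"
  have "(\<integral>\<^sup>+t. ennreal (f t * (1 / binlen tau js j / f t)) * indicator (bin tau js j) t \<partial>lborel)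
    = (\<integral>\<^sup>+t. ennreal (1 / binlen tau js j) * indicator (bin tau js j) t \<partial>lborel)"
    using f_pos by (intro nn_integral_cong arg_cong2[of _ _ _ _ "(*)"] arg_cong[where f = ennreal] refl) (simp add: less_imp_neq[symmetric])
  also have "\<dots> = ennreal (1 / binlen tau js j) * ennreal (binlen tau js j)"
    using bin_borel[OF js] bin_lborel[OF js j] by (simp add: nn_integral_cmult_indicator)
  also have "\<dots> = 1" using binlen_pos[OF js j] by (subst ennreal_mult[symmetric]) auto
  finally show "(\<integral>\<^sup>+t. ennreal (f t * (1 / binlen tau js j / f t)) * indicator (bin tau js j) t \<partial>lborel) \<le> 1" by simp
qed auto

lemma nn_integral_marg_over_proj:
  assumes js: "js \<in> partitions K" and a: "\<And>j. j \<in> {1..nbins js} \<Longrightarrow> a j > 0"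
  shows "(\<integral>\<^sup>+x. ennreal (marg a n js x / (\<Prod>i<n. proj js (x i))) \<partial>sample_measure f n) \<le> 1"
proof (rule nn_integral_marg_ratio_le_1[OF js a proj_borel[OF js] proj_nonneg[OF js]])
  fix j assume j: "j \<in> {1..nbins js}"
  have binb[measurable]: "bin tau js j \<in> sets borel" by (rule bin_borel[OF js])
  have "(\<integral>\<^sup>+t. ennreal (f t * (1 / binlen tau js j / proj js t)) * indicator (bin tau js j) t \<partial>lborel)
    = (\<integral>\<^sup>+t. ennreal (1 / mass js j) * (ennreal (f t) * indicator (bin tau js j) t) \<partial>lborel)"
  proof (rule nn_integral_cong)
    fix t
    show "ennreal (f t * (1 / binlen tau js j / proj js t)) * indicator (bin tau js j) t
      = ennreal (1 / mass js j) * (ennreal (f t) * indicator (bin tau js j) t)"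
    proof (cases "t \<in> bin tau js j")
      case True
      have "f t * (1 / binlen tau js j / proj js t) = 1 / mass js j * f t"
        using binlen_pos[OF js j] by (simp add: proj_def step_eq[OF js j True])
      then show ?thesis using True mass_pos[OF js j] f_pos[of t]
        by (simp only: indicator_simps mult_1_right) (intro ennreal_mult, auto)
    qed simp
  qed
  also have "\<dots> = ennreal (1 / mass js j) * ennreal (mass js j)"
    by (subst nn_integral_cmult) (simp_all add: mass_eq[OF js j])
  also have "\<dots> = 1" using mass_pos[OF js j] by (subst ennreal_mult[symmetric]) auto
  finally show "(\<integral>\<^sup>+t. ennreal (f t * (1 / binlen tau js j / proj js t)) * indicator (bin tau js j) t \<partial>lborel) \<le> 1" by simp
qed auto

lemma one_minus_power_le_exp:
  fixes h :: real assumes "h \<le> 1" shows "(1 - h) ^ n \<le> exp (- real n * h)"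
proof -
  have "(1 - h) ^ n \<le> exp (- h) ^ n"
    using assms exp_ge_add_one_self[of "- h"] by (intro power_mono) auto
  then show ?thesis by (simp flip: exp_of_nat_mult)
qed

text \<open>The expected product is the \<open>n\<close>-th power of the Hellinger affinity
  \<open>1 - H / 2\<close>, hence at most \<open>exp (- n * H / 2)\<close>.\<close>

lemma nn_integral_sqrt_proj_ratio:
  assumes js: "js \<in> partitions K"
  shows "(\<integral>\<^sup>+x. ennreal (exp (real n * hellinger_sq f (proj js) / 2) * (\<Prod>i<n. sqrt (proj js (x i) / f (x i)))) \<partial>sample_measure f n) \<le> 1"
proof -
  let ?H = "hellinger_sq f (proj js)"
  let ?I = "LINT t:{0..1}|lborel. sqrt (f t * proj js t)"
  have [measurable]: "proj js \<in> borel_measurable borel" by (rule proj_borel[OF js])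
  have f0: "f t \<ge> 0" for t using f_pos[of t] by simp
  note h = f_borel proj_borel[OF js] f0 f_int proj_nonneg[OF js] set_integrable_proj[OF js]
  have I0: "?I \<ge> 0" unfolding set_lebesgue_integral_def
    by (rule integral_nonneg_AE) (use f0 proj_nonneg[OF js] in \<open>auto simp: indicator_def\<close>)
  have "?H = 2 - 2 * ?I" using hellinger_sq_eq[OF h] f_one integral_proj[OF js] by simp
  then have I: "?I = 1 - ?H / 2" by (simp add: diff_divide_distrib)
  have "(\<integral>\<^sup>+x. ennreal (\<Prod>i<n. sqrt (proj js (x i) / f (x i))) \<partial>sample_measure f n)
    = (\<integral>\<^sup>+t. ennreal (f t * sqrt (proj js t / f t)) * indicator {0..1} t \<partial>lborel) ^ n"
    using f0 proj_nonneg[OF js] by (intro nn_integral_sample_prod) auto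
  also have "(\<lambda>t. f t * sqrt (proj js t / f t)) = (\<lambda>t. sqrt (f t * proj js t))"
  proof
    fix t
    have "f t * proj js t = (f t)\<^sup>2 * (proj js t / f t)" using f_pos[of t] by (simp add: power2_eq_square)
    then show "f t * sqrt (proj js t / f t) = sqrt (f t * proj js t)"
      using f0[of t] by (simp only: real_sqrt_mult real_sqrt_abs2 real_sqrt_abs abs_of_nonneg)
  qed
  also have "(\<integral>\<^sup>+t. ennreal (sqrt (f t * proj js t)) * indicator {0..1} t \<partial>lborel) = ennreal ?I"
    using f0 proj_nonneg[OF js] set_integrable_sqrt_mult[OF h] by (intro nn_integral_unit_interval) auto
  also have "ennreal ?I ^ n = ennreal (?I ^ n)" using I0 by (rule ennreal_power)
  also have "\<dots> \<le> ennreal (exp (- real n * (?H / 2)))"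
    unfolding I using I0 I by (intro ennreal_leI one_minus_power_le_exp) linarith
  finally have le: "(\<integral>\<^sup>+x. ennreal (\<Prod>i<n. sqrt (proj js (x i) / f (x i))) \<partial>sample_measure f n)
    \<le> ennreal (exp (- real n * (?H / 2)))" .
  have "(\<integral>\<^sup>+x. ennreal (exp (real n * ?H / 2) * (\<Prod>i<n. sqrt (proj js (x i) / f (x i)))) \<partial>sample_measure f n)
    = ennreal (exp (real n * ?H / 2)) * (\<integral>\<^sup>+x. ennreal (\<Prod>i<n. sqrt (proj js (x i) / f (x i))) \<partial>sample_measure f n)"
    using f0 proj_nonneg[OF js]
    by (subst nn_integral_cmult[symmetric])
      (auto intro!: nn_integral_cong ennreal_mult prod_nonneg measurable_compose[OF borel_sample_prod])
  also have "\<dots> \<le> ennreal (exp (real n * ?H / 2)) * ennreal (exp (- real n * (?H / 2)))"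
    using le by (rule mult_left_mono) simp
  also have "\<dots> = 1" by (subst ennreal_mult[symmetric]) (auto simp flip: exp_add)
  finally show ?thesis .
qed

text \<open>A chi-square bound. With \<open>p\<close> for the projection,
  \<open>f\<^sup>2 / p = 2 * f - p + (f - p)\<^sup>2 / p\<close>; the first two terms integrate to 1
  and the last is at most \<open>\<delta>\<^sup>2 / c\<close> because \<open>p \<ge> c\<close>. By
  Markov's inequality the likelihood of the reference projection is then rarely far below that of
  \<open>f\<close>.\<close>

lemma nn_integral_density_over_proj:
  assumes js: "js \<in> partitions K" and \<delta>: "\<And>t. t \<in> {0..1} \<Longrightarrow> \<bar>f t - proj js t\<bar> \<le> \<delta>"
  shows "(\<integral>\<^sup>+x. ennreal (\<Prod>i<n. f (x i) / proj js (x i)) \<partial>sample_measure f n) \<le> ennreal (exp (real n * (\<delta>\<^sup>2 / c)))"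
proof -
  have [measurable]: "proj js \<in> borel_measurable borel" by (rule proj_borel[OF js])
  have f0: "f t \<ge> 0" for t using f_pos[of t] by simp
  let ?g = "\<lambda>t. 2 * f t - proj js t + \<delta>\<^sup>2 / c"
  have le: "f t * (f t / proj js t) \<le> ?g t" if t: "t \<in> {0..1}" for t
  proof -
    let ?p = "proj js t"
    have p: "?p \<ge> c" "?p > 0" using proj_ge[OF js t] c_pos by auto
    have "f t * (f t / ?p) = 2 * f t - ?p + (f t - ?p)\<^sup>2 / ?p"
      using p by (simp add: field_simps power2_eq_square)
    also have "(f t - ?p)\<^sup>2 / ?p \<le> \<delta>\<^sup>2 / c"
      using \<delta>[OF t] p c_pos by (intro frac_le) (auto simp: abs_le_square_iff[symmetric])
    finally show ?thesis by simp
  qed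
  have nn: "f t * (f t / proj js t) \<ge> 0" for t using f0 proj_nonneg[OF js] by simp
  have const: "set_integrable lborel {0..1} (\<lambda>t::real. \<delta>\<^sup>2 / c)"
    by (simp add: set_integrable_def)
  have gi: "set_integrable lborel {0..1} ?g"
    using f_int set_integrable_proj[OF js] const by (intro set_integral_add set_integral_diff set_integrable_mult_right)
  have "(LINT t:{0..1}|lborel. ?g t) = 2 * 1 - 1 + \<delta>\<^sup>2 / c"
    using f_int set_integrable_proj[OF js] const f_one integral_proj[OF js]
    by (subst set_integral_add(2), simp_all add: set_integral_diff)
       (simp add: set_lebesgue_integral_def)
  then have gI: "(LINT t:{0..1}|lborel. ?g t) = 1 + \<delta>\<^sup>2 / c" by simp
  have "(\<integral>\<^sup>+x. ennreal (\<Prod>i<n. f (x i) / proj js (x i)) \<partial>sample_measure f n)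
    = (\<integral>\<^sup>+t. ennreal (f t * (f t / proj js t)) * indicator {0..1} t \<partial>lborel) ^ n"
    using f0 proj_nonneg[OF js] by (intro nn_integral_sample_prod) auto
  also have "\<dots> \<le> (\<integral>\<^sup>+t. ennreal (?g t) * indicator {0..1} t \<partial>lborel) ^ n"
    using le by (intro power_mono nn_integral_mono) (auto intro!: ennreal_leI split: split_indicator)
  also have "(\<integral>\<^sup>+t. ennreal (?g t) * indicator {0..1} t \<partial>lborel) = ennreal (1 + \<delta>\<^sup>2 / c)"
    unfolding gI[symmetric] using le nn by (intro nn_integral_unit_interval gi) (metis order_trans)
  also have "\<dots> ^ n = ennreal ((1 + \<delta>\<^sup>2 / c) ^ n)"
    using c_pos by (intro ennreal_power) auto
  also have "(1 + \<delta>\<^sup>2 / c) ^ n \<le> exp (\<delta>\<^sup>2 / c) ^ n"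
    using c_pos exp_ge_add_one_self by (intro power_mono) auto
  then have "ennreal ((1 + \<delta>\<^sup>2 / c) ^ n) \<le> ennreal (exp (real n * (\<delta>\<^sup>2 / c)))"
    by (intro ennreal_leI) (simp only: exp_of_nat_mult)
  finally show ?thesis .
qed

lemma nn_integral_sum_partitions_le:
  fixes g :: "nat \<Rightarrow> real" and X :: "nat list \<Rightarrow> (nat \<Rightarrow> real) \<Rightarrow> real"
  assumes g: "\<And>k. k \<in> {1..K} \<Longrightarrow> g k \<ge> 0"
    and X: "\<And>js. js \<in> partitions K \<Longrightarrow> X js \<in> borel_measurable (sample_measure f n)"
      "\<And>js. js \<in> partitions K \<Longrightarrow> (\<integral>\<^sup>+x. ennreal (X js x) \<partial>sample_measure f n) \<le> 1"
      "\<And>js x. js \<in> partitions K \<Longrightarrow> X js x \<ge> 0"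
  shows "(\<integral>\<^sup>+x. ennreal (\<Sum>js\<in>partitions K. g (nbins js) / real ((K - 1) choose (nbins js - 1)) * X js x)
      \<partial>sample_measure f n) \<le> ennreal (\<Sum>k=1..K. g k)"
proof -
  let ?r = "\<lambda>js. g (nbins js) / real ((K - 1) choose (nbins js - 1))"
  have r: "?r js \<ge> 0" if "js \<in> partitions K" for js
    using g[of "nbins js"] partitionsD(1)[OF that] partitions_nbins_le[OF that] by simp
  have "ennreal (\<Sum>js\<in>partitions K. ?r js * X js x) = (\<Sum>js\<in>partitions K. ennreal (?r js) * ennreal (X js x))" for x
  proof -
    have "(\<Sum>js\<in>partitions K. ennreal (?r js * X js x)) = ennreal (\<Sum>js\<in>partitions K. ?r js * X js x)"
      using r X(3) by (intro sum_ennreal mult_nonneg_nonneg)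
    moreover have "ennreal (?r js * X js x) = ennreal (?r js) * ennreal (X js x)" if "js \<in> partitions K" for js
      using r[OF that] X(3)[OF that] by (rule ennreal_mult)
    ultimately show ?thesis by (simp cong: sum.cong)
  qed
  then have "(\<integral>\<^sup>+x. ennreal (\<Sum>js\<in>partitions K. ?r js * X js x) \<partial>sample_measure f n)
      = (\<integral>\<^sup>+x. (\<Sum>js\<in>partitions K. ennreal (?r js) * ennreal (X js x)) \<partial>sample_measure f n)"
    by simp
  also have "\<dots>
    = (\<Sum>js\<in>partitions K. ennreal (?r js) * (\<integral>\<^sup>+x. ennreal (X js x) \<partial>sample_measure f n))"
    using X(1) by (subst nn_integral_sum) (auto intro!: sum.cong nn_integral_cmult)
  also have "\<dots> \<le> (\<Sum>js\<in>partitions K. ennreal (?r js) * 1)"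
    using X(2) by (intro sum_mono mult_left_mono) auto
  also have "\<dots> = ennreal (\<Sum>js\<in>partitions K. ?r js)"
    unfolding mult_1_right using r by (rule sum_ennreal)
  also have "\<dots> \<le> ennreal (\<Sum>k=1..K. g k)"
    using g by (intro ennreal_leI sum_partitions_le)
  finally show ?thesis .
qed

end

section \<open>Prior smoothing of the frequencies, and existence of a MAP partition\<close>

lemma sqrt_diff_power2_le:
  fixes x y :: real assumes "x \<ge> 0" "y \<ge> 0"
  shows "(sqrt x - sqrt y)\<^sup>2 \<le> \<bar>x - y\<bar>"
proof -
  have "(sqrt x - sqrt y)\<^sup>2 = \<bar>sqrt x - sqrt y\<bar> * \<bar>sqrt x - sqrt y\<bar>"
    by (simp add: power2_eq_square flip: abs_mult)
  also have "\<dots> \<le> \<bar>sqrt x - sqrt y\<bar> * (sqrt x + sqrt y)"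
    using assms by (intro mult_left_mono) (auto simp: abs_if)
  also have "\<dots> = \<bar>(sqrt x - sqrt y) * (sqrt x + sqrt y)\<bar>"
    using assms by (simp add: abs_mult)
  also have "(sqrt x - sqrt y) * (sqrt x + sqrt y) = x - y"
    using assms by (simp add: algebra_simps)
  finally show ?thesis .
qed

text \<open>Bayes weights mix the frequencies with the prior means \<open>a j / A\<close> in
  proportion \<open>n : A\<close>. This moves at most \<open>2 * A / (A + n)\<close> in total
  absolute difference, which dominates the squared Hellinger distance.\<close>

lemma sum_sqrt_diff_smoothing:
  fixes a :: "nat \<Rightarrow> real"
  assumes n: "n \<ge> 1" and k: "k \<ge> 1" and N: "(\<Sum>j=1..k. N j) = n" and a: "\<And>j. j \<in> {1..k} \<Longrightarrow> a j > 0"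
  defines "A \<equiv> \<Sum>j=1..k. a j"
  shows "(\<Sum>j=1..k. (sqrt (real (N j) / real n) - sqrt ((a j + real (N j)) / (A + real n)))\<^sup>2) \<le> 2 * A / real n"
proof -
  have A: "A > 0" unfolding A_def using a k by (intro sum_pos) auto
  have "(\<Sum>j=1..k. (sqrt (real (N j) / real n) - sqrt ((a j + real (N j)) / (A + real n)))\<^sup>2)
    \<le> (\<Sum>j=1..k. (A * real (N j) + real n * a j) / (real n * (A + real n)))"
  proof (rule sum_mono)
    fix j assume "j \<in> {1..k}"
    note aj = a[OF this]
    have "(sqrt (real (N j) / real n) - sqrt ((a j + real (N j)) / (A + real n)))\<^sup>2
      \<le> \<bar>real (N j) / real n - (a j + real (N j)) / (A + real n)\<bar>"
      using aj A by (intro sqrt_diff_power2_le) auto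
    also have "real (N j) / real n - (a j + real (N j)) / (A + real n)
        = (A * real (N j) - real n * a j) / (real n * (A + real n))"
      using n A by (subst diff_frac_eq) (auto simp: algebra_simps)
    also have "\<bar>\<dots>\<bar> = \<bar>A * real (N j) - real n * a j\<bar> / (real n * (A + real n))"
      using A by simp
    also have "\<dots> \<le> (A * real (N j) + real n * a j) / (real n * (A + real n))"
      using A aj by (intro divide_right_mono) (auto simp: abs_le_iff)
    finally show "(sqrt (real (N j) / real n) - sqrt ((a j + real (N j)) / (A + real n)))\<^sup>2
      \<le> (A * real (N j) + real n * a j) / (real n * (A + real n))" .
  qed
  also have "\<dots> = (A * real n + real n * A) / (real n * (A + real n))"
    unfolding sum_divide_distrib[symmetric] sum.distrib sum_distrib_left[symmetric] A_def[symmetric]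
    by (simp flip: N)
  also have "\<dots> = real n * (2 * A) / (real n * (A + real n))" by (simp add: algebra_simps)
  also have "\<dots> = 2 * A / (A + real n)" using n by simp
  also have "\<dots> \<le> 2 * A / real n" using n A by (intro divide_left_mono) auto
  finally show ?thesis .
qed

lemma map_partitions_nonempty: "K \<ge> 1 \<Longrightarrow> map_partitions n K p a tau x \<noteq> {}"
proof -
  assume "K \<ge> 1"
  then obtain js0 where "js0 \<in> partitions K" using quasi_uniform_partition[of 1 K] by auto
  then have "partitions K \<noteq> {}" by auto
  moreover define s where "s = (\<lambda>js. post_score n K p (a js) tau x js)"
  ultimately obtain js where "js \<in> partitions K" "s js = Max (s ` partitions K)"
    using Max_in[of "s ` partitions K"] finite_partitions by (metis (no_types, lifting) finite_imageI image_iff image_is_empty)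
  then have "js \<in> map_partitions n K p a tau x"
    using finite_partitions by (auto simp: map_partitions_def s_def)
  then show ?thesis by auto
qed

text \<open>The \<open>Max\<close> in \<open>map_loss\<close> ranges over a finite nonempty set, so
  the worst loss is the loss at some MAP partition and it suffices to bound each one.\<close>

lemma map_loss_attained:
  assumes "K \<ge> 1"
  obtains js where "js \<in> map_partitions n K p a tau x"
    "map_loss f n K p a tau x = hellinger_sq f (hist_est n (a js) tau x js)"
proof -
  have "finite (map_partitions n K p a tau x)"
    using finite_partitions by (rule rev_finite_subset) (auto simp: map_partitions_def)
  then have "map_loss f n K p a tau x \<in> (\<lambda>js. hellinger_sq f (hist_est n (a js) tau x js)) ` map_partitions n K p a tau x"
    unfolding map_loss_def using map_partitions_nonempty[OF assms] by (intro Max_in) auto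
  then show ?thesis using that by auto
qed

section \<open>Marginal likelihood and loss at a fixed sample size\<close>

text \<open>With the sample size fixed, the asymptotic hypotheses become plain inequalities and no
  constant can depend on \<open>n\<close> unnoticed. \<open>lnK\<close> is what a grid of size O(n)
  gives for large \<open>n\<close>; \<open>r\<close> stays free until
  \<open>map_loss_rate\<close>.\<close>

locale map_model = hist_density +
  fixes n :: nat and p :: "nat \<Rightarrow> real" and a :: "nat list \<Rightarrow> nat \<Rightarrow> real" and \<sigma> s L r D1 d1 :: real
  assumes n1: "n \<ge> 1" and L: "L = ln (real n)" "L \<ge> 1" and lnK: "ln (real K) \<le> 2 * L" and r1: "r \<ge> 1"
    and p_sum: "(\<Sum>k=1..K. p k) = 1" and p_ge: "\<And>k. k \<in> {1..K} \<Longrightarrow> D1 * exp (- d1 * real k * ln (real k)) \<le> p k"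
    and D1: "D1 > 0" "d1 > 0" and sig: "\<sigma> > 0" "s > 0"
    and a_bounds: "\<And>js j. js \<in> partitions K \<Longrightarrow> j \<in> {1..nbins js} \<Longrightarrow> \<sigma> / real (nbins js) \<le> a js j \<and> a js j \<le> s"
begin

lemma p_nonneg: "k \<in> {1..K} \<Longrightarrow> p k \<ge> 0"
  using p_ge[of k] D1 by (meson exp_ge_zero less_imp_le mult_nonneg_nonneg order_trans)

lemma p_le_1: "k \<in> {1..K} \<Longrightarrow> p k \<le> 1"
  unfolding p_sum[symmetric] using p_nonneg by (intro member_le_sum) auto

lemma exp_L: "exp L = real n"
  using n1 L by simp

lemma ln_le_2L: "k \<in> {1..K} \<Longrightarrow> ln (real k) \<le> 2 * L"
  using lnK by (rule order_trans[rotated]) auto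

text \<open>Price of one bin in \<open>marg_lower\<close>, in units of \<open>L\<close>: 3 for the
  factor \<open>1 / (k * n)\<close>, as \<open>ln k \<le> 2 * L\<close>; 2 for the term
  \<open>1 + ln n\<close>; \<open>2 * s\<close> for the total Dirichlet mass; the logarithm for the
  lower bound on the parameters.\<close>

definition C0 :: real where "C0 = 5 + 2 * s - ln (min \<sigma> 1)"

lemma C0_pos: "C0 > 0"
proof -
  have "ln (min \<sigma> 1) \<le> 0" using sig by simp
  then show ?thesis using sig unfolding C0_def by linarith
qed

definition loss_emp :: "nat list \<Rightarrow> (nat \<Rightarrow> real) \<Rightarrow> real" where
  "loss_emp js x = (\<Sum>j=1..nbins js. (sqrt (real (bincount n x tau js j) / real n) - sqrt (mass js j))\<^sup>2)"

context
  fixes js assumes js: "js \<in> partitions K"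
begin

lemma nb: "nbins js \<in> {1..K}"
  using partitionsD(1)[OF js] partitions_nbins_le[OF js] by simp

lemma a_pos: "j \<in> {1..nbins js} \<Longrightarrow> a js j > 0"
  using a_bounds[OF js] nb sig by (metis atLeastAtMost_iff divide_pos_pos less_le_trans of_nat_0_less_iff zero_less_one)

lemma sum_a_le: "(\<Sum>j=1..nbins js. a js j) \<le> s * real (nbins js)"
  using sum_bounded_above[of "{1..nbins js}" "a js" s] a_bounds[OF js] by (simp add: mult.commute)

text \<open>The left side is the inverse of the weight of \<open>js\<close> in the second and third
  averages; its factor \<open>K\<close> comes from the uniform weight \<open>1 / K\<close> on the
  number of bins.\<close>

lemma binom_le: "real K * real ((K - 1) choose (nbins js - 1)) \<le> exp (2 * real (nbins js) * L)"
proof -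
  have "(K - 1) choose (nbins js - 1) \<le> (K - 1) ^ (nbins js - 1)"
    using nb by (intro binomial_le_pow) auto
  also have "\<dots> \<le> K ^ (nbins js - 1)" by (intro power_mono) auto
  finally have "K * ((K - 1) choose (nbins js - 1)) \<le> K * K ^ (nbins js - 1)" by simp
  also have "\<dots> = K ^ nbins js" using nb by (cases "nbins js") auto
  finally have "real (K * ((K - 1) choose (nbins js - 1))) \<le> real (K ^ nbins js)" by (rule of_nat_mono)
  also have "\<dots> = exp (real (nbins js) * ln (real K))"
    using K_pos by (subst exp_of_nat_mult) auto
  also have "\<dots> \<le> exp (real (nbins js) * (2 * L))"
    unfolding exp_le_cancel_iff using lnK by (rule mult_left_mono) simp
  finally show ?thesis by (simp add: mult_ac)
qed

lemma binom_pos: "real ((K - 1) choose (nbins js - 1)) > 0"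
  using nb by (auto simp: zero_less_binomial_iff)

text \<open>The marginal likelihood is at least \<open>exp (- C0 * k * L)\<close> times the
  maximised likelihood, which in turn exceeds the likelihood of the projection by the factor
  \<open>exp (n * loss_emp js x)\<close>. The bin widths are common to both sides.\<close>

lemma marg_lower:
  assumes x: "\<forall>i<n. x i \<in> {0..1}"
  shows "exp (real n * loss_emp js x - C0 * real (nbins js) * L) * (\<Prod>i<n. proj js (x i)) \<le> marg (a js) n js x"
proof -
  define k where "k = nbins js"
  define N where "N = bincount n x tau js"
  \<comment> \<open>Capped at 1 because \<open>dirichlet_multinomial_lower\<close> needs its lower
    parameter bound to be at most 1.\<close>
  define m where "m = min \<sigma> 1"
  have k: "1 \<le> k" "k \<le> K" using nb by (auto simp: k_def)
  have m: "0 < m" "m \<le> 1" "m \<le> \<sigma>" using sig by (auto simp: m_def)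
  have Nn: "(\<Sum>j=1..k. N j) = n" unfolding k_def N_def using x by (intro sum_bincount[OF js]) auto
  have b: "0 < m / real k" "m / real k \<le> 1" using m k by (auto simp: divide_le_eq)
  have ab: "m / real k \<le> a js j \<and> a js j \<le> s" if "j \<in> {1..k}" for j
  proof -
    have "m / real k \<le> \<sigma> / real k" using m by (intro divide_right_mono) auto
    then show ?thesis using a_bounds[OF js, of j] that by (auto simp: k_def)
  qed
  have kL: "L \<le> real k * L" "1 \<le> real k * L" "real k \<le> real k * L"
    using k L(2) mult_mono[of 1 "real k" 1 L] mult_right_mono[of 1 "real k" L] by auto
  let ?E = "(m / real k / real n) ^ k * exp (- (1 + ln (real n) + s * real k * (1 + ln (real n))))"
  have "?E = exp (real k * ln (m / real k / real n) - (1 + L + s * real k * (1 + L)))"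
  proof -
    have "(m / real k / real n) ^ k = exp (real k * ln (m / real k / real n))"
    proof -
      have "m / real k / real n > 0" using m k n1 by simp
      then show ?thesis by (subst exp_of_nat_mult) (simp only: exp_ln)
    qed
    then show ?thesis by (simp add: L(1)[symmetric] flip: exp_add)
  qed
  moreover have "- C0 * real k * L \<le> real k * ln (m / real k / real n) - (1 + L + s * real k * (1 + L))"
  proof -
    have "ln (m / real k / real n) = ln m - ln (real k) - L"
      using m k n1 L by (simp add: ln_div ln_mult)
    moreover have "ln (real k) \<le> 2 * L" using k by (intro ln_le_2L) auto
    ultimately have "real k * ln (m / real k / real n) \<ge> real k * (ln m - 3 * L)"
      by (intro mult_left_mono) auto
    moreover have "real k * ln m \<ge> ln m * (real k * L)"
      using m kL(3) mult_left_mono_neg[of "real k" "real k * L" "ln m"] by (simp add: mult.commute)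
    moreover have "s * real k * (1 + L) \<le> 2 * s * (real k * L)"
      using sig kL(3) mult_left_mono[of "real k + real k * L" "2 * (real k * L)" s] by (simp add: algebra_simps)
    moreover have "- C0 * real k * L = - 5 * (real k * L) - 2 * s * (real k * L) + ln m * (real k * L)"
      by (simp add: C0_def m_def algebra_simps)
    moreover have "real k * (ln m - 3 * L) = real k * ln m - 3 * (real k * L)"
      by (simp add: algebra_simps)
    ultimately show ?thesis using kL by linarith
  qed
  ultimately have E: "exp (- C0 * real k * L) \<le> ?E" by simp
  have low: "?E * (\<Prod>j=1..k. (real (N j) / real n) ^ N j) \<le> dirichlet_multinomial (a js) k n N"
    by (rule dirichlet_multinomial_lower[OF k(1) n1 Nn b ab])
  have lr: "exp (real n * loss_emp js x) * (\<Prod>j=1..k. mass js j ^ N j) \<le> (\<Prod>j=1..k. (real (N j) / real n) ^ N j)"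
    unfolding loss_emp_def N_def[symmetric] k_def[symmetric]
    using mass_pos[OF js] sum_mass[OF js]
    by (intro empirical_likelihood_ratio[OF n1 Nn]) (auto simp: k_def less_imp_le)
  have pr: "(\<Prod>i<n. proj js (x i)) = (\<Prod>j=1..k. (mass js j / binlen tau js j) ^ N j)"
    unfolding k_def N_def using x step_eq[OF js] by (intro prod_bincount[OF js]) (auto simp: proj_def)
  have len: "(\<Prod>j=1..k. binlen tau js j ^ N j) > 0"
    using binlen_pos[OF js] by (intro prod_pos) (auto simp: k_def)
  have "exp (real n * loss_emp js x - C0 * real k * L) * (\<Prod>j=1..k. mass js j ^ N j)
    = exp (- C0 * real k * L) * (exp (real n * loss_emp js x) * (\<Prod>j=1..k. mass js j ^ N j))"
    by (simp add: exp_diff exp_minus divide_inverse)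
  also have "\<dots> \<le> ?E * (\<Prod>j=1..k. (real (N j) / real n) ^ N j)"
  proof (rule mult_mono[OF E lr])
    show "0 \<le> ?E" using m by (intro mult_nonneg_nonneg zero_le_power divide_nonneg_nonneg) auto
    show "0 \<le> exp (real n * loss_emp js x) * (\<Prod>j=1..k. mass js j ^ N j)"
      using mass_pos[OF js] by (intro mult_nonneg_nonneg prod_nonneg) (auto simp: k_def less_imp_le)
  qed
  also note low
  finally have "exp (real n * loss_emp js x - C0 * real k * L) * (\<Prod>j=1..k. mass js j ^ N j) / (\<Prod>j=1..k. binlen tau js j ^ N j)
    \<le> dirichlet_multinomial (a js) k n N / (\<Prod>j=1..k. binlen tau js j ^ N j)"
    using len by (intro divide_right_mono) auto
  then show ?thesis
    unfolding pr marg_def N_def[symmetric] k_def[symmetric] by (simp add: power_divide prod_dividef)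
qed

lemma post_score_marg:
  "post_score n K p (a js) tau x js = p (nbins js) / real ((K - 1) choose (nbins js - 1)) * marg (a js) n js x"
  unfolding marg_def using a_pos nb by (intro post_score_eq) auto

lemma sum_bayes_weights_le_1:
  "(\<Sum>j=1..nbins js. (a js j + real (bincount n x tau js j)) / ((\<Sum>j=1..nbins js. a js j) + real n)) \<le> 1"
proof -
  have "real (\<Sum>j=1..nbins js. bincount n x tau js j) \<le> real n"
    using sum_bincount_le[OF js] by (rule of_nat_mono)
  moreover have "(\<Sum>j=1..nbins js. a js j) > 0" using a_pos nb by (intro sum_pos) auto
  ultimately show ?thesis
    by (simp add: sum_divide_distrib[symmetric] sum.distrib divide_le_eq)
qed

lemma bayes_weight_nonneg:
  "j \<in> {1..nbins js} \<Longrightarrow> (a js j + real (bincount n x tau js j)) / ((\<Sum>j=1..nbins js. a js j) + real n) \<ge> 0"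
  using a_pos by (intro divide_nonneg_nonneg add_nonneg_nonneg sum_nonneg) (auto intro: less_imp_le)

lemma f_nonneg: "f t \<ge> 0" using f_pos[of t] by simp

lemma loss_le_2: "hellinger_sq f (hist_est n (a js) tau x js) \<le> 2"
proof -
  let ?c = "\<lambda>j. (a js j + real (bincount n x tau js j)) / ((\<Sum>j=1..nbins js. a js j) + real n)"
  have "hellinger_sq f (step js ?c) \<le> (LINT t:{0..1}|lborel. f t) + (LINT t:{0..1}|lborel. step js ?c t)"
    using f_nonneg f_int step_borel[OF js] step_nonneg[OF js bayes_weight_nonneg] set_integrable_step[OF js]
    by (intro hellinger_sq_le) auto
  also have "\<dots> \<le> 1 + 1"
    using sum_bayes_weights_le_1[of x] unfolding f_one integral_step[OF js] by simp
  finally show ?thesis unfolding hist_est_eq_step by simp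
qed

text \<open>The three terms are approximation error, error of the empirical frequencies, and prior
  smoothing. Splitting a square twice gives the factors 2 and 4; the 8 is 4 times the 2 of
  \<open>sum_sqrt_diff_smoothing\<close>.\<close>

lemma loss_decomposition:
  assumes x: "\<forall>i<n. x i \<in> {0..1}"
  shows "hellinger_sq f (hist_est n (a js) tau x js)
    \<le> 2 * hellinger_sq f (proj js) + 4 * loss_emp js x + 8 * s * real (nbins js) / real n"
proof -
  define N where "N = bincount n x tau js"
  define A where "A = (\<Sum>j=1..nbins js. a js j)"
  define w where "w = (\<lambda>j. (a js j + real (N j)) / (A + real n))"
  have w0: "w j \<ge> 0" if "j \<in> {1..nbins js}" for j
    unfolding w_def A_def N_def using bayes_weight_nonneg[OF that] .
  have m0: "mass js j \<ge> 0" if "j \<in> {1..nbins js}" for j using mass_pos[OF js that] by simp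
  have e: "hist_est n (a js) tau x js = step js w"
    by (simp add: hist_est_eq_step w_def A_def N_def)
  have Nn: "(\<Sum>j=1..nbins js. N j) = n" unfolding N_def using x by (intro sum_bincount[OF js]) auto
  have 1: "hellinger_sq f (step js w) \<le> 2 * hellinger_sq f (proj js) + 2 * hellinger_sq (proj js) (step js w)"
    using f_nonneg f_int step_borel[OF js] step_nonneg[OF js w0] set_integrable_step[OF js]
      proj_borel[OF js] proj_nonneg[OF js] set_integrable_proj[OF js]
    by (intro hellinger_sq_triangle) auto
  have "hellinger_sq (proj js) (step js w) = (\<Sum>j=1..nbins js. (sqrt (mass js j) - sqrt (w j))\<^sup>2)"
    unfolding proj_def using m0 w0 by (rule hellinger_sq_step[OF js])
  also have "\<dots> \<le> (\<Sum>j=1..nbins js. 2 * (sqrt (real (N j) / real n) - sqrt (mass js j))\<^sup>2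
      + 2 * (sqrt (real (N j) / real n) - sqrt (w j))\<^sup>2)"
  proof (rule sum_mono)
    fix j
    have "(a - c)\<^sup>2 \<le> 2 * (b - a)\<^sup>2 + 2 * (b - c)\<^sup>2" for a b c :: real
      using zero_le_power2[of "(a - b) - (b - c)"] by (simp add: power2_eq_square algebra_simps)
    then show "(sqrt (mass js j) - sqrt (w j))\<^sup>2 \<le> 2 * (sqrt (real (N j) / real n) - sqrt (mass js j))\<^sup>2
      + 2 * (sqrt (real (N j) / real n) - sqrt (w j))\<^sup>2" .
  qed
  also have "\<dots> = 2 * loss_emp js x + 2 * (\<Sum>j=1..nbins js. (sqrt (real (N j) / real n) - sqrt (w j))\<^sup>2)"
    by (simp add: sum.distrib sum_distrib_left loss_emp_def N_def)
  also have "\<dots> \<le> 2 * loss_emp js x + 2 * (2 * A / real n)"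
    unfolding w_def A_def using nb a_pos by (intro add_left_mono mult_left_mono sum_sqrt_diff_smoothing n1 Nn) auto
  also have "2 * A / real n \<le> 2 * (s * real (nbins js)) / real n"
    using sum_a_le by (intro divide_right_mono mult_left_mono) (auto simp: A_def)
  finally have "hellinger_sq (proj js) (step js w) \<le> 2 * loss_emp js x + 4 * (s * real (nbins js) / real n)"
    by simp
  then show ?thesis using 1 unfolding e by simp
qed

end

end

section \<open>The loss on and off the Markov events\<close>

lemma prod_sqrt: "(\<Prod>i<n. sqrt (g i)) = sqrt (\<Prod>i<n. g i)" for n :: nat
  by (induction n) (simp_all add: real_sqrt_mult)

text \<open>\<open>js0\<close> is the reference partition and \<open>R\<close> the cutoff for the
  number of bins. The exponent in \<open>tail\<close> is \<open>C5 + 1\<close>, so that the prior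
  mass beyond \<open>R\<close> lies a factor \<open>exp (- r * L)\<close> below the level guaranteed
  by the score of \<open>js0\<close>.\<close>

locale map_rate = map_model +
  fixes js0 :: "nat list" and \<delta> C1 C2 R :: real
  assumes js0: "js0 \<in> partitions K" and js0_le: "real (nbins js0) \<le> 2 * r"
    and \<delta>: "\<And>t. t \<in> {0..1} \<Longrightarrow> \<bar>f t - proj js0 t\<bar> \<le> \<delta>" and \<delta>_le: "real n * (\<delta>\<^sup>2 / c) \<le> C2 * (r * L)"
    and R_le: "R \<le> C1 * r"
    and tail: "(\<Sum>k=1..K. if R < real k then p k else 0)
      \<le> exp (- (2 * (2 * d1 + 2 + C0) + C2 + \<bar>ln D1\<bar> + 2) * (r * L))"
begin

abbreviation "W \<equiv> r * L"
text \<open>The reference partition has \<open>k * L \<le> 2 * W\<close> and pays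
  \<open>2 * d1\<close> for the prior, 2 for the binomial and \<open>C0\<close> for the marginal
  likelihood, per unit of \<open>k * L\<close>. \<open>C2 + 1\<close> is the exponent of the
  threshold for \<open>T4\<close>, and the last term absorbs \<open>D1\<close>.\<close>

definition C5 :: real where "C5 = 2 * (2 * d1 + 2 + C0) + (C2 + 1) + \<bar>ln D1\<bar>"
text \<open>Collects \<open>loss_decomposition\<close> with \<open>k * L \<le> C1 * W\<close>:
  approximation error \<open>(9 * C1 + C5) * W / n\<close>, frequency error
  \<open>(C0 + 3) * C1 * W / n\<close>, smoothing \<open>s * C1 * W / n\<close>.\<close>

definition C6 :: real where "C6 = 2 * (9 * C1 + C5) + 4 * (C0 + 3) * C1 + 8 * s * C1"

lemma W_ge: "L \<le> W" "1 \<le> W"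
  using r1 L(2) mult_mono[of 1 r 1 L] mult_right_mono[of 1 r L] by auto

definition mixture :: "(nat \<Rightarrow> real) \<Rightarrow> (nat list \<Rightarrow> (nat \<Rightarrow> real) \<Rightarrow> real) \<Rightarrow> (nat \<Rightarrow> real) \<Rightarrow> real" where
  "mixture g X x = (\<Sum>js\<in>partitions K. g (nbins js) / real ((K - 1) choose (nbins js - 1)) * X js x)"

text \<open>Small \<open>T1\<close> bounds the number of bins of the MAP partition, \<open>T2\<close> its empirical bin frequencies, \<open>T3\<close> its
  approximation error, and \<open>T4\<close> bounds the score of the reference partition \<open>js0\<close> from below.\<close>

definition T1 :: "(nat \<Rightarrow> real) \<Rightarrow> real" where
  "T1 = mixture (\<lambda>k. if R < real k then p k else 0) (\<lambda>js x. marg (a js) n js x / (\<Prod>i<n. f (x i)))"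
definition T2 :: "(nat \<Rightarrow> real) \<Rightarrow> real" where
  "T2 = mixture (\<lambda>k. 1 / real K) (\<lambda>js x. marg (a js) n js x / (\<Prod>i<n. proj js (x i)))"
definition T3 :: "(nat \<Rightarrow> real) \<Rightarrow> real" where
  "T3 = mixture (\<lambda>k. 1 / real K)
     (\<lambda>js x. exp (real n * hellinger_sq f (proj js) / 2) * (\<Prod>i<n. sqrt (proj js (x i) / f (x i))))"
definition T4 :: "(nat \<Rightarrow> real) \<Rightarrow> real" where
  "T4 x = (\<Prod>i<n. f (x i) / proj js0 (x i))"

lemma mixture_ge:
  assumes "\<And>k. k \<in> {1..K} \<Longrightarrow> g k \<ge> 0" "\<And>js. js \<in> partitions K \<Longrightarrow> X js x \<ge> 0" "js \<in> partitions K"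
  shows "g (nbins js) / real ((K - 1) choose (nbins js - 1)) * X js x \<le> mixture g X x"
  unfolding mixture_def
  by (rule member_le_sum[of js "partitions K" "\<lambda>js. g (nbins js) / real ((K - 1) choose (nbins js - 1)) * X js x"])
    (use assms nb finite_partitions in \<open>auto intro!: mult_nonneg_nonneg divide_nonneg_nonneg simp del: times_divide_eq_left\<close>)

lemma mixture_nonneg:
  assumes "\<And>k. k \<in> {1..K} \<Longrightarrow> g k \<ge> 0" "\<And>js. js \<in> partitions K \<Longrightarrow> X js x \<ge> 0"
  shows "mixture g X x \<ge> 0"
  unfolding mixture_def using assms nb
  by (intro sum_nonneg mult_nonneg_nonneg divide_nonneg_nonneg) auto

lemma mixture_borel:
  assumes "\<And>js. js \<in> partitions K \<Longrightarrow> X js \<in> borel_measurable (sample_measure f n)"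
  shows "mixture g X \<in> borel_measurable (sample_measure f n)"
  unfolding mixture_def[abs_def] using assms by (intro borel_measurable_sum borel_measurable_times) auto

lemma X1_nonneg: "js \<in> partitions K \<Longrightarrow> marg (a js) n js x / (\<Prod>i<n. f (x i)) \<ge> 0"
  using marg_pos[of js "a js" n x] a_pos[of js] f_pos
  by (intro divide_nonneg_nonneg prod_nonneg) (auto intro: less_imp_le)

lemma X2_nonneg: "js \<in> partitions K \<Longrightarrow> marg (a js) n js x / (\<Prod>i<n. proj js (x i)) \<ge> 0"
  using marg_pos[of js "a js" n x] a_pos[of js] proj_nonneg[of js]
  by (intro divide_nonneg_nonneg prod_nonneg) (auto intro: less_imp_le)

lemma X3_nonneg: "js \<in> partitions K \<Longrightarrow>
    exp (real n * hellinger_sq f (proj js) / 2) * (\<Prod>i<n. sqrt (proj js (x i) / f (x i))) \<ge> 0"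
  using proj_nonneg[of js] f_nonneg[of js] by (intro mult_nonneg_nonneg prod_nonneg) auto

lemma X1_borel: "js \<in> partitions K \<Longrightarrow>
    (\<lambda>x. marg (a js) n js x / (\<Prod>i<n. f (x i))) \<in> borel_measurable (sample_measure f n)"
  by (intro borel_measurable_divide marg_borel borel_sample_prod f_borel)

lemma X2_borel: "js \<in> partitions K \<Longrightarrow>
    (\<lambda>x. marg (a js) n js x / (\<Prod>i<n. proj js (x i))) \<in> borel_measurable (sample_measure f n)"
  by (intro borel_measurable_divide marg_borel borel_sample_prod proj_borel)

lemma X3_borel:
  assumes js: "js \<in> partitions K"
  shows "(\<lambda>x. exp (real n * hellinger_sq f (proj js) / 2) * (\<Prod>i<n. sqrt (proj js (x i) / f (x i))))
    \<in> borel_measurable (sample_measure f n)"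
proof -
  have [measurable]: "proj js \<in> borel_measurable borel" by (rule proj_borel[OF js])
  have "(\<lambda>t. sqrt (proj js t / f t)) \<in> borel_measurable borel" by measurable
  from borel_sample_prod[OF this] show ?thesis by (intro borel_measurable_times) auto
qed

lemma T_borel:
  "T1 \<in> borel_measurable (sample_measure f n)" "T2 \<in> borel_measurable (sample_measure f n)"
  "T3 \<in> borel_measurable (sample_measure f n)" "T4 \<in> borel_measurable (sample_measure f n)"
proof -
  show "T1 \<in> borel_measurable (sample_measure f n)" unfolding T1_def by (intro mixture_borel X1_borel)
  show "T2 \<in> borel_measurable (sample_measure f n)" unfolding T2_def by (intro mixture_borel X2_borel)
  show "T3 \<in> borel_measurable (sample_measure f n)" unfolding T3_def by (intro mixture_borel X3_borel)
  show "T4 \<in> borel_measurable (sample_measure f n)" unfolding T4_def[abs_def]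
    by (intro borel_sample_prod borel_measurable_divide f_borel proj_borel[OF js0])
qed

lemma T_nonneg: "T1 x \<ge> 0" "T2 x \<ge> 0" "T3 x \<ge> 0" "T4 x \<ge> 0"
proof -
  show "T1 x \<ge> 0" unfolding T1_def using p_nonneg X1_nonneg by (intro mixture_nonneg) auto
  show "T2 x \<ge> 0" unfolding T2_def using X2_nonneg by (intro mixture_nonneg) auto
  show "T3 x \<ge> 0" unfolding T3_def using X3_nonneg by (intro mixture_nonneg) auto
  show "T4 x \<ge> 0" unfolding T4_def using f_pos proj_nonneg[OF js0]
    by (intro prod_nonneg divide_nonneg_nonneg) (auto intro: less_imp_le)
qed

lemma nn_integral_T1: "(\<integral>\<^sup>+x. ennreal (T1 x) \<partial>sample_measure f n) \<le> ennreal (exp (- (C5 + 1) * W))"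
proof -
  have "(\<integral>\<^sup>+x. ennreal (T1 x) \<partial>sample_measure f n) \<le> ennreal (\<Sum>k=1..K. if R < real k then p k else 0)"
    unfolding T1_def mixture_def using p_nonneg
    by (intro nn_integral_sum_partitions_le X1_borel X1_nonneg nn_integral_marg_over_density a_pos) auto
  also have "\<dots> \<le> ennreal (exp (- (C5 + 1) * W))"
    using tail by (intro ennreal_leI) (simp add: C5_def add_ac)
  finally show ?thesis .
qed

lemma nn_integral_T2: "(\<integral>\<^sup>+x. ennreal (T2 x) \<partial>sample_measure f n) \<le> 1"
proof -
  have "(\<integral>\<^sup>+x. ennreal (T2 x) \<partial>sample_measure f n) \<le> ennreal (\<Sum>k=1..K. 1 / real K)"
    unfolding T2_def mixture_def
    by (intro nn_integral_sum_partitions_le X2_borel X2_nonneg nn_integral_marg_over_proj a_pos) auto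
  then show ?thesis using K_pos by simp
qed

lemma nn_integral_T3: "(\<integral>\<^sup>+x. ennreal (T3 x) \<partial>sample_measure f n) \<le> 1"
proof -
  have "(\<integral>\<^sup>+x. ennreal (T3 x) \<partial>sample_measure f n) \<le> ennreal (\<Sum>k=1..K. 1 / real K)"
    unfolding T3_def mixture_def
    by (intro nn_integral_sum_partitions_le X3_borel X3_nonneg nn_integral_sqrt_proj_ratio) auto
  then show ?thesis using K_pos by simp
qed

lemma nn_integral_T4: "(\<integral>\<^sup>+x. ennreal (T4 x) \<partial>sample_measure f n) \<le> ennreal (exp (C2 * W))"
  unfolding T4_def using \<delta>_le
  by (intro order_trans[OF nn_integral_density_over_proj[OF js0 \<delta>]] ennreal_leI) auto

lemma map_post_score_lower:
  assumes x: "\<forall>i<n. x i \<in> {0..1}" and js: "js \<in> map_partitions n K p a tau x" and T4: "T4 x \<le> exp ((C2 + 1) * W)"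
  shows "exp (- C5 * W) * (\<Prod>i<n. f (x i)) \<le> post_score n K p (a js) tau x js"
proof -
  define k where "k = nbins js0"
  define b where "b = real ((K - 1) choose (k - 1))"
  define q where "q = (\<Prod>i<n. proj js0 (x i))"
  have k: "k \<in> {1..K}" unfolding k_def by (rule nb[OF js0])
  have b: "b > 0" unfolding b_def k_def by (rule binom_pos[OF js0])
  have q: "q > 0" unfolding q_def
    using x proj_ge[OF js0] c_pos by (intro prod_pos) (meson lessThan_iff less_le_trans)
  have kL: "real k * L \<le> 2 * W"
    using mult_right_mono[OF js0_le, of L] L(2) by (simp add: k_def)
  have T4': "T4 x = (\<Prod>i<n. f (x i)) / q" unfolding T4_def q_def by (rule prod_dividef)
  have fq: "(\<Prod>i<n. f (x i)) \<le> exp ((C2 + 1) * W) * q"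
    using T4 q unfolding T4' by (simp add: divide_le_eq)
  have bK: "b \<le> exp (2 * (real k * L))"
  proof -
    have "b \<le> real K * b" using K_pos b by simp
    also have "\<dots> \<le> exp (2 * real k * L)" unfolding b_def k_def by (rule binom_le[OF js0])
    finally show ?thesis by (simp add: mult_ac)
  qed
  have D: "exp (- \<bar>ln D1\<bar> * W) \<le> D1"
  proof -
    have "- \<bar>ln D1\<bar> * W \<le> - \<bar>ln D1\<bar> * 1" using W_ge by (intro mult_left_mono_neg) auto
    also have "\<dots> \<le> ln D1" by simp
    finally have "exp (- \<bar>ln D1\<bar> * W) \<le> exp (ln D1)" by (rule iffD2[OF exp_le_cancel_iff])
    then show ?thesis using D1 by simp
  qed
  have "exp (- \<bar>ln D1\<bar> * W) * exp (- 2 * d1 * (real k * L)) \<le> D1 * exp (- d1 * real k * ln (real k))"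
  proof (rule mult_mono[OF D])
    have "d1 * real k * ln (real k) \<le> d1 * real k * (2 * L)"
      using ln_le_2L[OF k] D1 by (intro mult_left_mono) auto
    then show "exp (- 2 * d1 * (real k * L)) \<le> exp (- d1 * real k * ln (real k))" by (simp add: mult_ac)
  qed (use D1 in auto)
  also note p_ge[OF k]
  finally have pk: "exp (- \<bar>ln D1\<bar> * W - 2 * d1 * (real k * L)) \<le> p k"
    by (simp add: exp_diff exp_minus divide_inverse)
  \<comment> \<open>For the reference partition the gain of the maximised likelihood over the
    projection is simply dropped.\<close>
  have emp: "loss_emp js0 x \<ge> 0" unfolding loss_emp_def by (intro sum_nonneg) auto
  have m: "exp (- C0 * (real k * L)) * q \<le> marg (a js0) n js0 x"
  proof -
    have "- C0 * (real k * L) \<le> real n * loss_emp js0 x - C0 * real k * L"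
      using emp by simp
    then have "exp (- C0 * (real k * L)) * q \<le> exp (real n * loss_emp js0 x - C0 * real k * L) * q"
      using q by (intro mult_right_mono) auto
    also have "\<dots> \<le> marg (a js0) n js0 x" unfolding q_def k_def by (rule marg_lower[OF js0 x])
    finally show ?thesis .
  qed
  have "exp (- C5 * W) * (\<Prod>i<n. f (x i)) \<le> exp (- C5 * W) * (exp ((C2 + 1) * W) * q)"
    using fq by (intro mult_left_mono) auto
  also have "\<dots> = exp (- \<bar>ln D1\<bar> * W - (2 * d1 + 2 + C0) * (2 * W)) * q"
  proof -
    have "- C5 * W + (C2 + 1) * W = - \<bar>ln D1\<bar> * W - (2 * d1 + 2 + C0) * (2 * W)"
      by (simp add: C5_def algebra_simps)
    then show ?thesis by (simp only: mult.assoc[symmetric] exp_add[symmetric])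
  qed
  also have "\<dots> \<le> exp (- \<bar>ln D1\<bar> * W - (2 * d1 + 2 + C0) * (real k * L)) * q"
    using kL D1 C0_pos q by (intro mult_right_mono) (auto intro!: mult_left_mono)
  also have "\<dots> = exp (- \<bar>ln D1\<bar> * W - 2 * d1 * (real k * L)) / exp (2 * (real k * L)) * (exp (- C0 * (real k * L)) * q)"
  proof -
    have "- \<bar>ln D1\<bar> * W - (2 * d1 + 2 + C0) * (real k * L)
        = - \<bar>ln D1\<bar> * W - 2 * d1 * (real k * L) - 2 * (real k * L) + - C0 * (real k * L)"
      by (simp add: algebra_simps)
    then show ?thesis by (simp only: mult.assoc[symmetric] exp_diff[symmetric] exp_add[symmetric])
  qed
  also have "\<dots> \<le> p k / b * marg (a js0) n js0 x"
    using pk bK b m q p_nonneg[OF k] by (intro mult_mono frac_le) (auto intro: order_trans[OF exp_ge_zero])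
  also have "\<dots> = post_score n K p (a js0) tau x js0"
    unfolding k_def b_def by (rule post_score_marg[OF js0, symmetric])
  also have "\<dots> \<le> post_score n K p (a js) tau x js"
    using js js0 by (auto simp: map_partitions_def)
  finally show ?thesis .
qed

lemma loss_good_event:
  assumes x: "\<forall>i<n. x i \<in> {0..1}" and js: "js \<in> map_partitions n K p a tau x"
    and T1: "T1 x < exp (- C5 * W)" and T2: "T2 x \<le> real n" and T3: "T3 x \<le> real n"
    and T4: "T4 x \<le> exp ((C2 + 1) * W)"
  shows "hellinger_sq f (hist_est n (a js) tau x js) \<le> C6 * W / real n"
proof -
  define k where "k = nbins js"
  define b where "b = real ((K - 1) choose (k - 1))"
  define q where "q = (\<Prod>i<n. proj js (x i))"
  define F where "F = (\<Prod>i<n. f (x i))"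
  define H where "H = hellinger_sq f (proj js)"
  define m where "m = marg (a js) n js x"
  have jsP: "js \<in> partitions K" using js by (simp add: map_partitions_def)
  have k: "k \<in> {1..K}" unfolding k_def by (rule nb[OF jsP])
  have b: "b > 0" unfolding b_def k_def by (rule binom_pos[OF jsP])
  have q: "q > 0" unfolding q_def
    using x proj_ge[OF jsP] c_pos by (intro prod_pos) (meson lessThan_iff less_le_trans)
  have F: "F > 0" unfolding F_def using f_pos by (intro prod_pos) auto
  have m: "m > 0" unfolding m_def by (rule marg_pos[OF jsP a_pos[OF jsP]])
  have score: "exp (- C5 * W) * F \<le> p k / b * m"
    using map_post_score_lower[OF x js T4] unfolding post_score_marg[OF jsP] F_def k_def b_def m_def .
  \<comment> \<open>With more than \<open>R\<close> bins, the score divided by the likelihood of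
    \<open>f\<close> would be a summand of \<open>T1\<close>, yet
    \<open>map_post_score_lower\<close> puts it above the threshold for \<open>T1\<close>.\<close>
  have kR: "real k \<le> R"
  proof (rule ccontr)
    assume "\<not> real k \<le> R"
    then have "p k / b * (m / F) \<le> T1 x"
      using mixture_ge[OF _ _ jsP, of "\<lambda>k. if R < real k then p k else 0" "\<lambda>js x. marg (a js) n js x / (\<Prod>i<n. f (x i))" x]
        p_nonneg X1_nonneg unfolding T1_def by (auto simp: k_def b_def m_def F_def)
    moreover have "exp (- C5 * W) \<le> p k / b * (m / F)"
      using score F by (simp only: times_divide_eq_right[of "p k / b"] le_divide_eq if_True)
    ultimately show False using T1 by simp
  qed
  have kL: "real k * L \<le> C1 * W"
    using mult_right_mono[of "real k" "C1 * r" L] kR R_le L(2) by (simp add: mult_ac)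
  have LkL: "L \<le> real k * L" using mult_right_mono[of 1 "real k" L] k L(2) by simp
  have bK: "real K * b \<le> exp (2 * (real k * L))"
    using binom_le[OF jsP] by (simp add: b_def k_def mult_ac)
  \<comment> \<open>\<open>n\<close> is the threshold for \<open>T2\<close> and \<open>T3\<close>,
    and \<open>K * b\<close> the inverse weight of the partition; at least one bin is present, so
    \<open>n\<close> costs one more \<open>k * L\<close>.\<close>
  have nbK: "real n * (real K * b) \<le> exp (3 * (real k * L))"
  proof -
    have "real n * (real K * b) \<le> exp L * exp (2 * (real k * L))"
      unfolding exp_L using bK by (intro mult_left_mono) auto
    also have "\<dots> = exp (L + 2 * (real k * L))" by (simp add: exp_add)
    also have "\<dots> \<le> exp (3 * (real k * L))" unfolding exp_le_cancel_iff using LkL by linarith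
    finally show ?thesis .
  qed
  have "1 / real K / b * (m / q) \<le> real n"
    using mixture_ge[OF _ _ jsP, of "\<lambda>k. 1 / real K" "\<lambda>js x. marg (a js) n js x / (\<Prod>i<n. proj js (x i))" x]
      X2_nonneg T2 unfolding T2_def by (auto simp: k_def b_def m_def q_def)
  then have "m \<le> real n * (real K * b) * q"
    using b q K_pos by (simp add: divide_le_eq mult_ac)
  also have "\<dots> \<le> exp (3 * (real k * L)) * q" using nbK q by (intro mult_right_mono) auto
  finally have mq: "m \<le> exp (3 * (real k * L)) * q" .
  \<comment> \<open>\<open>marg_lower\<close> and \<open>T2\<close> bound the same marginal
    likelihood from both sides by multiples of \<open>q\<close>, which cancels.\<close>
  have S: "real n * loss_emp js x \<le> (C0 + 3) * (real k * L)"
  proof -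
    have "exp (real n * loss_emp js x - C0 * real k * L) * q \<le> m"
      unfolding m_def q_def k_def by (rule marg_lower[OF jsP x])
    also note mq
    finally have "exp (real n * loss_emp js x - C0 * real k * L) \<le> exp (3 * (real k * L))" using q by simp
    then show ?thesis by (simp add: algebra_simps)
  qed
  have pr: "(\<Prod>i<n. sqrt (proj js (x i) / f (x i))) = sqrt (q / F)"
    unfolding q_def F_def prod_dividef[symmetric]
    using prod_sqrt[of "\<lambda>i. proj js (x i) / f (x i)"] by simp
  have "1 / real K / b * (exp (real n * H / 2) * sqrt (q / F)) \<le> real n"
    using mixture_ge[OF _ _ jsP, of "\<lambda>k. 1 / real K" "\<lambda>js x. exp (real n * hellinger_sq f (proj js) / 2) * (\<Prod>i<n. sqrt (proj js (x i) / f (x i)))" x]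
      X3_nonneg T3 unfolding T3_def pr by (auto simp: k_def b_def H_def pr)
  then have "exp (real n * H / 2) * sqrt (q / F) \<le> real n * (real K * b)"
    using b K_pos by (simp add: divide_le_eq mult_ac)
  also note nbK
  finally have "(exp (real n * H / 2) * sqrt (q / F))\<^sup>2 \<le> (exp (3 * (real k * L)))\<^sup>2"
    using q F by (intro power_mono) auto
  then have qF: "exp (real n * H) * (q / F) \<le> exp (6 * (real k * L))"
    using q F by (simp add: power_mult_distrib flip: exp_double)
  \<comment> \<open>\<open>T3\<close> bounds \<open>exp (n * H) * (q / F)\<close> above. The MAP
    score together with \<open>mq\<close> keeps \<open>q / F\<close> from being small, since it is
    at least \<open>exp (- C5 * W - 3 * k * L)\<close>. Hence 9 = 6 + 3.\<close>
  have "real n * H \<le> 9 * (real k * L) + C5 * W"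
  proof -
    have "exp (- C5 * W) * F \<le> p k / b * m" by (rule score)
    also have "\<dots> \<le> 1 * m"
    proof (intro mult_right_mono)
      have "(K - 1) choose (k - 1) \<ge> 1" using b unfolding b_def of_nat_0_less_iff by linarith
      then have "1 \<le> b" unfolding b_def by linarith
      then show "p k / b \<le> 1" using p_le_1[OF k] b by (simp add: divide_le_eq)
    qed (use m in auto)
    also have "\<dots> \<le> exp (3 * (real k * L)) * q" using mq by simp
    finally have "exp (- C5 * W) \<le> exp (3 * (real k * L)) * (q / F)" using F by (simp add: le_divide_eq)
    then have "exp (real n * H) * exp (- C5 * W) \<le> exp (real n * H) * (exp (3 * (real k * L)) * (q / F))"
      by (intro mult_left_mono) auto
    also have "\<dots> = exp (3 * (real k * L)) * (exp (real n * H) * (q / F))" by (simp only: mult_ac)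
    also have "\<dots> \<le> exp (3 * (real k * L)) * exp (6 * (real k * L))"
      using qF by (intro mult_left_mono) auto
    finally have "real n * H + - C5 * W \<le> 3 * (real k * L) + 6 * (real k * L)"
      by (simp only: exp_add[symmetric] exp_le_cancel_iff)
    then show ?thesis by linarith
  qed
  moreover have "real k \<le> real k * L" using mult_left_mono[of 1 L "real k"] L(2) by simp
  then have "s * real k \<le> s * (C1 * W)" using kL sig by (intro mult_left_mono) auto
  moreover have "(C0 + 3) * (real k * L) \<le> (C0 + 3) * (C1 * W)"
    using kL C0_pos by (intro mult_left_mono) auto
  moreover have "2 * h + 4 * e + 8 * t \<le> 2 * (9 * u + z) + 4 * g + 8 * v"
    if "h \<le> 9 * y + z" "t \<le> v" "e' \<le> g" "e \<le> e'" "y \<le> u" for h e e' t u z g v y :: real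
  proof -
    have "h \<le> 9 * u + z" "e \<le> g" using that by linarith+
    then show ?thesis using that(2) by (intro add_mono mult_left_mono) auto
  qed
  ultimately have "2 * (real n * H) + 4 * (real n * loss_emp js x) + 8 * (s * real k)
      \<le> 2 * (9 * (C1 * W) + C5 * W) + 4 * ((C0 + 3) * (C1 * W)) + 8 * (s * (C1 * W))"
    using S kL by blast
  also have "\<dots> = C6 * W" by (simp add: C6_def algebra_simps)
  finally have *: "2 * (real n * H) + 4 * (real n * loss_emp js x) + 8 * (s * real k) \<le> C6 * W" .
  have "hellinger_sq f (hist_est n (a js) tau x js) \<le> 2 * H + 4 * loss_emp js x + 8 * s * real k / real n"
    unfolding H_def k_def by (rule loss_decomposition[OF jsP x])
  also have "\<dots> = (2 * (real n * H) + 4 * (real n * loss_emp js x) + 8 * (s * real k)) / real n"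
    using n1 by (simp add: add_divide_distrib)
  also have "\<dots> \<le> C6 * W / real n" using * by (intro divide_right_mono) auto
  finally show ?thesis .
qed

text \<open>Markov's inequality before integration: the indicator of a bad event is at most the
  variable divided by its threshold, and the loss is at most 2. The bound is measurable in
  \<open>x\<close>, so monotonicity of the integral suffices for \<open>map_loss\<close>.\<close>

lemma map_loss_pointwise:
  assumes x: "\<forall>i<n. x i \<in> {0..1}" and C6: "C6 \<ge> 0"
  shows "map_loss f n K p a tau x \<le> C6 * W / real n + (2 * exp (C5 * W) * T1 x + 2 / real n * T2 x
    + 2 / real n * T3 x + 2 * exp (- (C2 + 1) * W) * T4 x)"
proof -
  obtain js where js: "js \<in> map_partitions n K p a tau x"
    and eq: "map_loss f n K p a tau x = hellinger_sq f (hist_est n (a js) tau x js)"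
    using map_loss_attained[OF K_pos, where f = f and n = n and p = p and a = a and tau = tau and x = x] .
  let ?e = "hellinger_sq f (hist_est n (a js) tau x js)"
  have "js \<in> partitions K" using js by (simp add: map_partitions_def)
  then have e2: "?e \<le> 2" by (rule loss_le_2)
  have base: "0 \<le> C6 * W / real n" using C6 W_ge by simp
  have nn: "0 \<le> 2 * exp (C5 * W) * T1 x" "0 \<le> 2 / real n * T2 x" "0 \<le> 2 / real n * T3 x"
    "0 \<le> 2 * exp (- (C2 + 1) * W) * T4 x" using T_nonneg[of x] by auto
  consider "T1 x \<ge> exp (- C5 * W)" | "T2 x > real n" | "T3 x > real n" | "T4 x > exp ((C2 + 1) * W)"
    | "T1 x < exp (- C5 * W)" "T2 x \<le> real n" "T3 x \<le> real n" "T4 x \<le> exp ((C2 + 1) * W)"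
    by linarith
  then show ?thesis unfolding eq
  proof cases
    case 1
    have "2 = 2 * exp (C5 * W) * exp (- C5 * W)" by (simp flip: exp_add)
    also have "\<dots> \<le> 2 * exp (C5 * W) * T1 x" using 1 by (intro mult_left_mono) auto
    finally show "?e \<le> C6 * W / real n + (2 * exp (C5 * W) * T1 x + 2 / real n * T2 x
      + 2 / real n * T3 x + 2 * exp (- (C2 + 1) * W) * T4 x)" using e2 base nn by linarith
  next
    case 2
    then have "2 / real n * real n \<le> 2 / real n * T2 x" by (intro mult_left_mono) auto
    then have "2 \<le> 2 / real n * T2 x" using n1 by simp
    then show "?e \<le> C6 * W / real n + (2 * exp (C5 * W) * T1 x + 2 / real n * T2 x
      + 2 / real n * T3 x + 2 * exp (- (C2 + 1) * W) * T4 x)" using e2 base nn by linarith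
  next
    case 3
    then have "2 / real n * real n \<le> 2 / real n * T3 x" by (intro mult_left_mono) auto
    then have "2 \<le> 2 / real n * T3 x" using n1 by simp
    then show "?e \<le> C6 * W / real n + (2 * exp (C5 * W) * T1 x + 2 / real n * T2 x
      + 2 / real n * T3 x + 2 * exp (- (C2 + 1) * W) * T4 x)" using e2 base nn by linarith
  next
    case 4
    have "2 = 2 * exp (- (C2 + 1) * W) * exp ((C2 + 1) * W)"
      by (simp only: mult.assoc exp_add[symmetric]) (simp add: algebra_simps)
    also have "\<dots> \<le> 2 * exp (- (C2 + 1) * W) * T4 x" using 4 by (intro mult_left_mono) auto
    finally show "?e \<le> C6 * W / real n + (2 * exp (C5 * W) * T1 x + 2 / real n * T2 x
      + 2 / real n * T3 x + 2 * exp (- (C2 + 1) * W) * T4 x)" using e2 base nn by linarith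
  next
    case 5
    then show "?e \<le> C6 * W / real n + (2 * exp (C5 * W) * T1 x + 2 / real n * T2 x
      + 2 / real n * T3 x + 2 * exp (- (C2 + 1) * W) * T4 x)"
      using loss_good_event[OF x js] nn by linarith
  qed
qed

lemma nn_integral_map_loss:
  assumes C6: "C6 \<ge> 0"
  shows "(\<integral>\<^sup>+x. ennreal (map_loss f n K p a tau x) \<partial>sample_measure f n) \<le> ennreal ((C6 + 8) * (W / real n))"
proof -
  let ?S = "sample_measure f n"
  note [measurable] = T_borel
  have base: "0 \<le> C6 * W / real n" using C6 W_ge by simp
  interpret S: prob_space ?S
    unfolding sample_measure_def by (rule prob_space_PiM) (rule M.prob_space_axioms)
  have "(\<integral>\<^sup>+x. ennreal (map_loss f n K p a tau x) \<partial>?S)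
    \<le> (\<integral>\<^sup>+x. ennreal (C6 * W / real n + (2 * exp (C5 * W) * T1 x + 2 / real n * T2 x
      + 2 / real n * T3 x + 2 * exp (- (C2 + 1) * W) * T4 x)) \<partial>?S)"
    by (intro nn_integral_mono_AE eventually_mono[OF AE_sample] ennreal_leI map_loss_pointwise C6)
  also have "\<dots> = (\<integral>\<^sup>+x. ennreal (C6 * W / real n) + (ennreal (2 * exp (C5 * W)) * ennreal (T1 x)
      + ennreal (2 / real n) * ennreal (T2 x)
      + ennreal (2 / real n) * ennreal (T3 x) + ennreal (2 * exp (- (C2 + 1) * W)) * ennreal (T4 x)) \<partial>?S)"
    using T_nonneg base by (intro nn_integral_cong) (simp add: ennreal_mult[symmetric] ennreal_plus[symmetric] del: ennreal_plus)
  also have "\<dots> = ennreal (C6 * W / real n) + (ennreal (2 * exp (C5 * W)) * (\<integral>\<^sup>+x. ennreal (T1 x) \<partial>?S)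
      + ennreal (2 / real n) * (\<integral>\<^sup>+x. ennreal (T2 x) \<partial>?S)
      + ennreal (2 / real n) * (\<integral>\<^sup>+x. ennreal (T3 x) \<partial>?S)
      + ennreal (2 * exp (- (C2 + 1) * W)) * (\<integral>\<^sup>+x. ennreal (T4 x) \<partial>?S))"
    by (simp add: nn_integral_add nn_integral_cmult S.emeasure_space_1)
  also have "\<dots> \<le> ennreal (C6 * W / real n) + (ennreal (2 * exp (C5 * W)) * ennreal (exp (- (C5 + 1) * W))
      + ennreal (2 / real n) * ennreal 1 + ennreal (2 / real n) * ennreal 1
      + ennreal (2 * exp (- (C2 + 1) * W)) * ennreal (exp (C2 * W)))"
    using nn_integral_T1 nn_integral_T2 nn_integral_T3 nn_integral_T4
    by (intro add_mono mult_left_mono order_refl) (simp_all only: ennreal_1 zero_le)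
  also have "\<dots> = ennreal (C6 * W / real n + (2 * exp (C5 * W) * exp (- (C5 + 1) * W)
      + 2 / real n * 1 + 2 / real n * 1 + 2 * exp (- (C2 + 1) * W) * exp (C2 * W)))"
    using base by (simp add: ennreal_mult[symmetric] ennreal_plus[symmetric] del: ennreal_plus)
  also have "\<dots> \<le> ennreal ((C6 + 8) * (W / real n))"
  proof (rule ennreal_leI)
    \<comment> \<open>Each of the four bad events now contributes at most \<open>2 / n\<close>,
      since \<open>W \<ge> L = ln n\<close>. This is the 8 in the final constant.\<close>
    have e: "exp (- W) \<le> 1 / real n"
    proof -
      have "exp (- W) \<le> exp (- L)" using W_ge by simp
      also have "\<dots> = 1 / real n" by (simp add: exp_minus exp_L inverse_eq_divide)
      finally show ?thesis .
    qed
    have 1: "2 * exp (C5 * W) * exp (- (C5 + 1) * W) = 2 * exp (- W)"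
      by (simp add: algebra_simps flip: exp_add)
    have 2: "2 * exp (- (C2 + 1) * W) * exp (C2 * W) = 2 * exp (- W)"
      by (simp add: algebra_simps flip: exp_add)
    have "1 / real n \<le> W / real n" using W_ge by (intro divide_right_mono) auto
    moreover have "(C6 + 8) * (W / real n) = C6 * W / real n + 8 * (W / real n)" by (simp add: algebra_simps)
    ultimately show "C6 * W / real n + (2 * exp (C5 * W) * exp (- (C5 + 1) * W)
      + 2 / real n * 1 + 2 / real n * 1 + 2 * exp (- (C2 + 1) * W) * exp (C2 * W)) \<le> (C6 + 8) * (W / real n)"
      unfolding 1 2 using e by linarith
  qed
  finally show ?thesis .
qed

end

section \<open>Approximation error, prior tail and choice of the number of bins\<close>

lemma (in grid) tau_diff_le:
  assumes "\<And>j. 1 \<le> j \<Longrightarrow> j \<le> K \<Longrightarrow> tau j - tau (j - 1) \<le> h" and "i \<le> j" "j \<le> K"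
  shows "tau j - tau i \<le> real (j - i) * h"
  using assms(2,3)
proof (induction j rule: dec_induct)
  case (step j)
  then show ?case using assms(1)[of "Suc j"] by (simp add: Suc_diff_le algebra_simps)
qed simp

lemma (in hist_density) abs_diff_proj_le:
  assumes js: "js \<in> partitions K" and j: "j \<in> {1..nbins js}" and t: "t \<in> bin tau js j"
    and osc: "\<And>u. u \<in> bin tau js j \<Longrightarrow> \<bar>f u - f t\<bar> \<le> \<delta>"
  shows "\<bar>f t - proj js t\<bar> \<le> \<delta>"
proof -
  let ?l = "binlen tau js j"
  have l: "?l > 0" by (rule binlen_pos[OF js j])
  have \<delta>: "\<delta> \<ge> 0" using osc[OF t] by simp
  have const: "(\<integral>\<^sup>+u. ennreal d * indicator (bin tau js j) u \<partial>lborel) = ennreal (d * ?l)" if "d \<ge> 0" for d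
    using bin_borel[OF js] bin_lborel[OF js j] l that by (simp add: nn_integral_cmult_indicator ennreal_mult)
  have "ennreal (mass js j) \<le> ennreal ((f t + \<delta>) * ?l)"
  proof -
    have "(\<integral>\<^sup>+u. ennreal (f u) * indicator (bin tau js j) u \<partial>lborel)
        \<le> (\<integral>\<^sup>+u. ennreal (f t + \<delta>) * indicator (bin tau js j) u \<partial>lborel)"
      using osc by (intro nn_integral_mono) (force intro!: ennreal_leI simp: abs_le_iff split: split_indicator)
    then show ?thesis using const[of "f t + \<delta>"] \<delta> f_pos[of t] by (simp add: mass_eq[OF js j])
  qed
  then have up: "mass js j \<le> (f t + \<delta>) * ?l" using l \<delta> f_pos[of t] by simp
  have lo: "(f t - \<delta>) * ?l \<le> mass js j"
  \<comment> \<open>The lower comparison integrates the constant \<open>f t - \<delta>\<close> as an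
    extended nonnegative real; if it is negative, the claim is trivial.\<close>
  proof (cases "f t - \<delta> \<ge> 0")
    case True
    have "(\<integral>\<^sup>+u. ennreal (f t - \<delta>) * indicator (bin tau js j) u \<partial>lborel)
      \<le> (\<integral>\<^sup>+u. ennreal (f u) * indicator (bin tau js j) u \<partial>lborel)"
      using osc by (intro nn_integral_mono) (force intro!: ennreal_leI simp: abs_le_iff split: split_indicator)
    then have "ennreal ((f t - \<delta>) * ?l) \<le> ennreal (mass js j)"
      using const[OF True] by (simp add: mass_eq[OF js j])
    then show ?thesis using mass_pos[OF js j] by simp
  next
    case False
    then have "(f t - \<delta>) * ?l \<le> 0" using l by (simp add: mult_le_0_iff)
    then show ?thesis using mass_pos[OF js j] by linarith
  qed
  have "proj js t = mass js j / ?l" unfolding proj_def by (rule step_eq[OF js j t])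
  moreover have "mass js j / ?l \<le> f t + \<delta>" "f t - \<delta> \<le> mass js j / ?l"
    using up lo l by (simp_all add: divide_le_eq le_divide_eq)
  ultimately show ?thesis by (simp add: abs_le_iff)
qed

lemma ln_le_half: "x > 0 \<Longrightarrow> ln x \<le> x / 2" for x :: real
  using ln_le_minus_one[of "x / 2"] ln_le_minus_one[of 2] by (simp add: ln_div)

text \<open>Since \<open>ln r\<close> is of order \<open>L\<close>, every \<open>k\<close> beyond
  \<open>C1 * r\<close> has \<open>k * ln k\<close> at least \<open>C1 * r * L / 6\<close>, so
  \<open>C1\<close> can buy any exponent. Of the amount bought, 2 pays for the \<open>K\<close>
  summands and the absolute logarithm for \<open>D2\<close>.\<close>

lemma sum_tail_le:
  fixes p :: "nat \<Rightarrow> real"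
  assumes p: "\<And>k. k \<in> {1..K} \<Longrightarrow> p k \<le> D2 * exp (- d2 * real k * ln (real k))"
    and pos: "D2 > 0" "d2 > 0" "C \<ge> 0" and K: "real K \<le> exp (2 * L)" and L: "L \<ge> 1" and r: "r \<ge> 1" "ln r \<ge> L / 6"
  defines "C1 \<equiv> 1 + 6 * (C + 2 + \<bar>ln D2\<bar>) / d2"
  shows "(\<Sum>k=1..K. if C1 * r < real k then p k else 0) \<le> exp (- C * (r * L))"
proof -
  have C1: "C1 \<ge> 1" "d2 * C1 / 6 \<ge> C + 2 + \<bar>ln D2\<bar>" using pos by (auto simp: C1_def field_simps)
  have rL: "r * L \<ge> L" "r * L \<ge> 1"
    using r L mult_mono[of 1 r 1 L] mult_right_mono[of 1 r L] by auto
  have D: "D2 \<le> exp (\<bar>ln D2\<bar> * (r * L))"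
  proof -
    have "ln D2 \<le> \<bar>ln D2\<bar> * 1" by simp
    also have "\<dots> \<le> \<bar>ln D2\<bar> * (r * L)" using rL by (intro mult_left_mono) auto
    finally have "exp (ln D2) \<le> exp (\<bar>ln D2\<bar> * (r * L))" by (rule iffD2[OF exp_le_cancel_iff])
    then show ?thesis using pos by simp
  qed
  let ?b = "exp (\<bar>ln D2\<bar> * (r * L)) * exp (- (C + 2 + \<bar>ln D2\<bar>) * (r * L))"
  have "(\<Sum>k=1..K. if C1 * r < real k then p k else 0) \<le> (\<Sum>k=1..K. ?b)"
  proof (rule sum_mono)
    fix k assume k: "k \<in> {1..K}"
    show "(if C1 * r < real k then p k else 0) \<le> ?b"
    proof (cases "C1 * r < real k")
      case True
      have rk: "r \<le> real k" using True C1 r mult_right_mono[of 1 C1 r] by linarith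
      have "(C1 * r) * (L / 6) \<le> real k * ln (real k)"
      proof (rule mult_mono)
        have "ln r \<le> ln (real k)" using rk r by simp
        then show "L / 6 \<le> ln (real k)" using r by linarith
      qed (use True L in auto)
      then have "d2 * ((C1 * r) * (L / 6)) \<le> d2 * (real k * ln (real k))" using pos by (intro mult_left_mono) auto
      moreover have "(C + 2 + \<bar>ln D2\<bar>) * (r * L) \<le> (d2 * C1 / 6) * (r * L)"
        using C1 rL by (intro mult_right_mono) auto
      moreover have "d2 * C1 / 6 * (r * L) = d2 * ((C1 * r) * (L / 6))" by simp
      ultimately have "(C + 2 + \<bar>ln D2\<bar>) * (r * L) \<le> d2 * (real k * ln (real k))"
        by (metis order_trans)
      then have "- d2 * real k * ln (real k) \<le> - (C + 2 + \<bar>ln D2\<bar>) * (r * L)"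
        by (simp only: mult_minus_left neg_le_iff_le mult.assoc)
      then have "D2 * exp (- d2 * real k * ln (real k)) \<le> ?b"
        using D pos by (intro mult_mono) auto
      then show ?thesis using p[OF k] True by simp
    qed simp
  qed
  also have "\<dots> = real K * ?b" by simp
  also have "\<dots> \<le> exp (2 * (r * L)) * ?b"
  proof (rule mult_right_mono)
    have "exp (2 * L) \<le> exp (2 * (r * L))" using rL by simp
    then show "real K \<le> exp (2 * (r * L))" using K by linarith
  qed simp
  also have "\<dots> = exp (- C * (r * L))"
  proof -
    have "2 * (r * L) + (\<bar>ln D2\<bar> * (r * L) + - (C + 2 + \<bar>ln D2\<bar>) * (r * L)) = - C * (r * L)"
      by (simp add: algebra_simps)
    then show ?thesis by (simp only: exp_add[symmetric])
  qed
  finally show ?thesis .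
qed

text \<open>The constants of the locales are rebuilt from the model parameters alone, so that one
  value visibly serves all \<open>n\<close>. Here \<open>C - 1\<close> is \<open>C5\<close>, and the
  final 8 comes from the bad events.\<close>

definition rate_const :: "real \<Rightarrow> real \<Rightarrow> real \<Rightarrow> real \<Rightarrow> real \<Rightarrow> real \<Rightarrow> real \<Rightarrow> real" where
  "rate_const \<sigma> s D1 D2 d1 d2 C2 =
     (let C0 = 5 + 2 * s - ln (min \<sigma> 1);
          C = 2 * (2 * d1 + 2 + C0) + C2 + \<bar>ln D1\<bar> + 2;
          C1 = 1 + 6 * (C + 2 + \<bar>ln D2\<bar>) / d2
      in 2 * (9 * C1 + (C - 1)) + 4 * (C0 + 3) * C1 + 8 * s * C1 + 8)"

context map_model
begin

lemma map_loss_rate: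
  assumes r: "r = (real n / L) powr (1 / (2 * \<alpha> + 1))" and alpha: "0 < \<alpha>" "\<alpha> \<le> 1"
    and rK: "nat \<lceil>r\<rceil> \<le> K"
    and p_le: "\<And>k. k \<in> {1..K} \<Longrightarrow> p k \<le> D2 * exp (- d2 * real k * ln (real k))" and D2: "D2 > 0" "d2 > 0"
    and hoelder: "\<And>u t. u \<in> {0..1} \<Longrightarrow> t \<in> {0..1} \<Longrightarrow> \<bar>f u - f t\<bar> \<le> L0 * \<bar>u - t\<bar> powr \<alpha>" and L0: "L0 > 0"
    and grid_max: "\<And>j. 1 \<le> j \<Longrightarrow> j \<le> K \<Longrightarrow> tau j - tau (j - 1) \<le> M / real K" and M: "M > 0"
  shows "(\<integral>\<^sup>+x. ennreal (map_loss f n K p a tau x) \<partial>sample_measure f n)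
    \<le> ennreal (rate_const \<sigma> s D1 D2 d1 d2 (L0\<^sup>2 * (2 * M) powr (2 * \<alpha>) / c)
        * ((real n / L) powr (- \<alpha> / (2 * \<alpha> + 1)))\<^sup>2)"
proof -
  \<comment> \<open>Bins of the reference partition have length at most \<open>2 * M / r\<close>, so
    the Hoelder condition gives \<open>\<delta>\<close> below; \<open>C2\<close> is what
    \<open>n * \<delta>\<^sup>2 / c\<close> leaves in units of \<open>r * L\<close>.\<close>
  define C2 where "C2 = L0\<^sup>2 * (2 * M) powr (2 * \<alpha>) / c"
  define C where "C = 2 * (2 * d1 + 2 + C0) + C2 + \<bar>ln D1\<bar> + 2"
  define C1 where "C1 = 1 + 6 * (C + 2 + \<bar>ln D2\<bar>) / d2"
  define \<delta> where "\<delta> = L0 * (2 * M / r) powr \<alpha>"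
  have C2: "C2 \<ge> 0" using c_pos by (simp add: C2_def)
  have C0: "C0 > 0" by (rule C0_pos)
  have C: "C \<ge> 1" using C2 C0 D1 by (simp add: C_def)
  have C1: "C1 \<ge> 0" using C D2 by (simp add: C1_def)
  have nL: "real n / L > 0" using n1 L(2) by simp
  \<comment> \<open>The balance that determines \<open>r\<close>: squared bias
    \<open>r powr (- 2 * \<alpha>)\<close> against \<open>r * L / n\<close>.\<close>
  have rn: "r powr (- 2 * \<alpha>) = r * L / real n"
  proof -
    have "r powr (2 * \<alpha> + 1) = real n / L"
    proof -
      have "1 / (2 * \<alpha> + 1) * (2 * \<alpha> + 1) = 1" using alpha by simp
      then show ?thesis using nL by (simp only: r powr_powr powr_one less_imp_le)
    qed
    then have "r powr (2 * \<alpha>) * r = real n / L" using r1 by (simp add: powr_add)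
    then have "r * L / real n = inverse (r powr (2 * \<alpha>))"
      using r1 L(2) n1 by (simp add: divide_eq_eq inverse_eq_divide eq_divide_eq mult_ac del: L(1))
    then show ?thesis by (simp add: powr_minus)
  qed
  obtain js0 where js0: "js0 \<in> partitions K" "nbins js0 = nat \<lceil>r\<rceil>"
    and steps: "\<And>j. 1 \<le> j \<Longrightarrow> j \<le> nat \<lceil>r\<rceil> \<Longrightarrow> real (js0 ! j - js0 ! (j - 1)) \<le> 2 * real K / real (nat \<lceil>r\<rceil>)"
  proof -
    have "1 \<le> nat \<lceil>r\<rceil>" using r1 by linarith
    from quasi_uniform_partition[OF this rK] show ?thesis using that by blast
  qed
  have rr: "r \<le> real (nat \<lceil>r\<rceil>)" "real (nat \<lceil>r\<rceil>) \<le> 2 * r" using r1 by linarith+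
  have len: "binlen tau js0 j \<le> 2 * M / r" if j: "j \<in> {1..nbins js0}" for j
  proof -
    have "binlen tau js0 j \<le> real (js0 ! j - js0 ! (j - 1)) * (M / real K)"
      unfolding binlen_def using partitionsD(5,6)[OF js0(1)] j
      by (intro tau_diff_le grid_max) (auto intro: less_imp_le)
    also have "\<dots> \<le> (2 * real K / real (nat \<lceil>r\<rceil>)) * (M / real K)"
      using steps[of j] j js0 M by (intro mult_right_mono) auto
    also have "\<dots> = 2 * M / real (nat \<lceil>r\<rceil>)" using K_pos by simp
    also have "\<dots> \<le> 2 * M / r" using rr r1 M by (intro divide_left_mono) auto
    finally show ?thesis .
  qed
  interpret R: map_rate K tau f c n p a \<sigma> s L r D1 d1 js0 \<delta> C1 C2 "C1 * r"
  proof
    show "real (nbins js0) \<le> 2 * r" using js0 rr by simp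
    show "\<bar>f t - proj js0 t\<bar> \<le> \<delta>" if t: "t \<in> {0..1}" for t
    proof -
      obtain j where j: "j \<in> {1..nbins js0}" "t \<in> bin tau js0 j" using bin_unique[OF js0(1) t] by blast
      show ?thesis
      proof (rule abs_diff_proj_le[OF js0(1) j])
        fix u assume u: "u \<in> bin tau js0 j"
        then have u01: "u \<in> {0..1}" using bin_subset[OF js0(1) j(1)] by blast
        have "\<bar>u - t\<bar> \<le> binlen tau js0 j"
          using u j(2) by (auto simp: bin_def binlen_def split: if_splits)
        then have "\<bar>u - t\<bar> \<le> 2 * M / r" using len[OF j(1)] by linarith
        then have "\<bar>u - t\<bar> powr \<alpha> \<le> (2 * M / r) powr \<alpha>" using alpha by (intro powr_mono2) auto
        then have "L0 * \<bar>u - t\<bar> powr \<alpha> \<le> \<delta>" unfolding \<delta>_def using L0 by (intro mult_left_mono) auto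
        then show "\<bar>f u - f t\<bar> \<le> \<delta>" using hoelder[OF u01 t] by linarith
      qed
    qed
    show "real n * (\<delta>\<^sup>2 / c) \<le> C2 * (r * L)"
    proof -
      have "((2 * M / r) powr \<alpha>)\<^sup>2 = (2 * M / r) powr (2 * \<alpha>)"
        using M r1 by (simp add: power2_eq_square flip: powr_add)
      also have "\<dots> = (2 * M) powr (2 * \<alpha>) * r powr (- 2 * \<alpha>)"
        using M r1 powr_minus[of r "2 * \<alpha>"] by (subst powr_divide) (simp_all add: divide_inverse)
      finally have "\<delta>\<^sup>2 = L0\<^sup>2 * (2 * M) powr (2 * \<alpha>) * (r * L / real n)"
        unfolding \<delta>_def power_mult_distrib rn by (simp add: mult_ac)
      then show ?thesis using n1 by (simp add: C2_def mult_ac)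
    qed
    have nK: "real K \<le> exp (2 * L)"
    proof -
      have "exp (ln (real K)) \<le> exp (2 * L)" using lnK by (rule iffD2[OF exp_le_cancel_iff])
      then show ?thesis using K_pos by simp
    qed
    \<comment> \<open>The 6 is 3 times 2: the exponent in \<open>r\<close> is at least 1/3 as
      \<open>\<alpha> \<le> 1\<close>, and \<open>ln L \<le> L / 2\<close> makes
      \<open>ln (n / L)\<close> at least \<open>L / 2\<close>.\<close>
    have "ln r \<ge> L / 6"
    proof -
      have "ln L \<le> L / 2" using L by (intro ln_le_half) auto
      then have "L / 2 \<le> ln (real n / L)" using n1 L by (simp add: ln_div)
      then have "1 / (2 * \<alpha> + 1) * (L / 2) \<le> 1 / (2 * \<alpha> + 1) * ln (real n / L)"
        using alpha by (intro mult_left_mono) auto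
      also have "\<dots> = ln r" unfolding r using nL by (simp add: ln_powr)
      finally have "1 / (2 * \<alpha> + 1) * (L / 2) \<le> ln r" .
      moreover have "1 / 3 \<le> 1 / (2 * \<alpha> + 1)" using alpha by (intro divide_left_mono) auto
      then have "1 / 3 * (L / 2) \<le> 1 / (2 * \<alpha> + 1) * (L / 2)" using L by (intro mult_right_mono) auto
      ultimately show ?thesis by linarith
    qed
    then show "(\<Sum>k=1..K. if C1 * r < real k then p k else 0)
        \<le> exp (- (2 * (2 * d1 + 2 + C0) + C2 + \<bar>ln D1\<bar> + 2) * (r * L))"
      unfolding C_def[symmetric] C1_def using p_le D2 C nK L(2) r1 by (intro sum_tail_le) auto
  qed (use js0 in auto)
  have C5: "R.C5 = C - 1" by (simp add: R.C5_def C_def)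
  have C6: "R.C6 + 8 = rate_const \<sigma> s D1 D2 d1 d2 C2"
    unfolding R.C6_def C5 rate_const_def Let_def C0_def[symmetric] C_def[symmetric] C1_def[symmetric] ..
  have "R.C6 \<ge> 0" unfolding R.C6_def C5 using C1 C C0 sig by simp
  from R.nn_integral_map_loss[OF this]
  have "(\<integral>\<^sup>+x. ennreal (map_loss f n K p a tau x) \<partial>sample_measure f n)
    \<le> ennreal (rate_const \<sigma> s D1 D2 d1 d2 C2 * (r * L / real n))" unfolding C6 .
  moreover have "((real n / L) powr (- \<alpha> / (2 * \<alpha> + 1)))\<^sup>2 = r powr (- 2 * \<alpha>)"
    unfolding r powr_powr using nL by (simp add: power2_eq_square flip: powr_add)
  ultimately show ?thesis unfolding rn C2_def by simp
qed

end

section \<open>From the asymptotic hypotheses to inequalities for all large sample sizes\<close>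

theorem theorem2:
  fixes f0 :: "real \<Rightarrow> real" and \<alpha> L0 :: real
    and kn :: "nat \<Rightarrow> nat" and tau :: "nat \<Rightarrow> nat \<Rightarrow> real"
    and p :: "nat \<Rightarrow> nat \<Rightarrow> real"
    and a :: "nat \<Rightarrow> nat list \<Rightarrow> nat \<Rightarrow> real"
    and D1 D2 d1 d2 \<sigma> \<Sigma> B :: real
  assumes f0_pos: "\<And>t. t \<in> {0..1} \<Longrightarrow> f0 t > 0"
    and f0_dens: "(LINT t:{0..1}|lborel. f0 t) = 1"
    and alpha: "0 < \<alpha>" "\<alpha> \<le> 1"
    and L0: "L0 > 0"
    and hoelder: "\<And>s t. s \<in> {0..1} \<Longrightarrow> t \<in> {0..1} \<Longrightarrow> \<bar>f0 s - f0 t\<bar> \<le> L0 * \<bar>s - t\<bar> powr \<alpha>"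
    and kn_pos: "\<And>n. kn n \<ge> 1"
    and kn_upper: "(\<lambda>n. real (kn n)) \<in> O(\<lambda>n. real n)"
    and kn_lower: "\<And>\<gamma>. 0 < \<gamma> \<Longrightarrow> \<gamma> < 1 \<Longrightarrow> (\<lambda>n. real n powr \<gamma>) \<in> O(\<lambda>n. real (kn n))"
    and grid0: "\<And>n. tau n 0 = 0"
    and grid1: "\<And>n. tau n (kn n) = 1"
    and grid_mono: "\<And>n j. 1 \<le> j \<Longrightarrow> j \<le> kn n \<Longrightarrow> tau n (j - 1) < tau n j"
    and p_pos: "\<And>n k. 1 \<le> k \<Longrightarrow> k \<le> kn n \<Longrightarrow> p n k > 0"
    and p_zero: "\<And>n k. \<not> (1 \<le> k \<and> k \<le> kn n) \<Longrightarrow> p n k = 0"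
    and p_sum: "\<And>n. (\<Sum>k=1..kn n. p n k) = 1"
    and D_pos: "D1 > 0" "D2 > 0" "d1 > 0" "d2 > 0"
    and p_bounds: "\<And>n k. 1 \<le> k \<Longrightarrow> k \<le> kn n \<Longrightarrow>
        D1 * exp (- d1 * real k * ln (real k)) \<le> p n k \<and> p n k \<le> D2 * exp (- d2 * real k * ln (real k))"
    and sig_pos: "\<sigma> > 0" "\<Sigma> > 0"
    and a_bounds: "\<And>n js j. js \<in> partitions (kn n) \<Longrightarrow> 1 \<le> j \<Longrightarrow> j \<le> nbins js \<Longrightarrow>
        \<sigma> / real (nbins js) \<le> a n js j \<and> a n js j \<le> \<Sigma>"
    and grid_max: "\<exists>C. \<forall>\<^sub>F n in sequentially. \<forall>j. 1 \<le> j \<and> j \<le> kn n \<longrightarrow>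
        tau n j - tau n (j - 1) \<le> C / real (kn n)"
    and B_pos: "B > 0"
    and grid_min: "\<And>n j. 1 \<le> j \<Longrightarrow> j \<le> kn n \<Longrightarrow> tau n j - tau n (j - 1) \<ge> B / real (kn n)"
  shows "\<exists>C. \<forall>\<^sub>F n in sequentially.
     (\<integral>\<^sup>+ x. ennreal (map_loss f0 n (kn n) (p n) (a n) (tau n) x) \<partial>sample_measure f0 n)
       \<le> ennreal (C * ((real n / ln (real n)) powr (- \<alpha> / (2 * \<alpha> + 1))) ^ 2)"
proof -
  \<comment> \<open>Extension by the boundary values makes the density continuous, hence Borel, and
    bounded below on the whole line; the sample law and the loss see only the unit interval.\<close>
  define f where "f = (\<lambda>t. f0 (max 0 (min 1 t)))"
  have f_eq: "f t = f0 t" if "t \<in> {0..1}" for t using that by (simp add: f_def)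
  have cont0: "continuous_on {0..1} f0"
  proof (rule continuous_on_def[THEN iffD2, rule_format])
    fix t :: real assume t: "t \<in> {0..1}"
    have "((\<lambda>u. L0 * \<bar>u - t\<bar> powr \<alpha>) \<longlongrightarrow> L0 * \<bar>t - t\<bar> powr \<alpha>) (at t within {0..1})"
      using alpha by (intro tendsto_intros tendsto_powr') auto
    then have lim: "((\<lambda>u. L0 * \<bar>u - t\<bar> powr \<alpha>) \<longlongrightarrow> 0) (at t within {0..1})" by simp
    have "((\<lambda>u. f0 u - f0 t) \<longlongrightarrow> 0) (at t within {0..1})"
      by (rule Lim_null_comparison[OF _ lim])
        (use hoelder t in \<open>auto simp: eventually_at_filter intro!: always_eventually\<close>)
    then show "(f0 \<longlongrightarrow> f0 t) (at t within {0..1})" by (simp add: LIM_zero_iff)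
  qed
  have contf: "continuous_on UNIV f" unfolding f_def
    by (rule continuous_on_compose2[OF cont0]) (auto intro!: continuous_intros)
  have f_borel: "f \<in> borel_measurable borel" using contf by (rule borel_measurable_continuous_onI)
  obtain t0 where t0: "t0 \<in> {0..1}" "\<And>t. t \<in> {0..1} \<Longrightarrow> f0 t0 \<le> f0 t"
    using continuous_attains_inf[OF _ _ cont0] by auto
  define c where "c = f0 t0"
  have c: "c > 0" "\<And>t. f t \<ge> c" using f0_pos t0 by (auto simp: c_def f_def)
  have f_int: "set_integrable lborel {0..1} f"
    by (rule borel_integrable_atLeastAtMost'[OF continuous_on_subset[OF contf]]) simp
  have f_one: "(LINT t:{0..1}|lborel. f t) = 1"
  proof -
    have "(LINT t:{0..1}|lborel. f t) = (LINT t:{0..1}|lborel. f0 t)"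
      using f_eq by (intro set_lebesgue_integral_cong) auto
    then show ?thesis using f0_dens by (rule trans)
  qed
  have sample: "sample_measure f0 n = sample_measure f n" for n
  proof -
    have "ennreal (f0 t) * indicator {0..1} t = ennreal (f t) * indicator {0..1} t" for t
      using f_eq by (auto simp: indicator_def)
    then show ?thesis by (simp add: sample_measure_def obs_measure_def)
  qed
  have loss: "map_loss f0 = map_loss f"
  proof -
    have "hellinger_sq f0 g = hellinger_sq f g" for g
      unfolding hellinger_sq_def using f_eq by (intro set_lebesgue_integral_cong) auto
    then show ?thesis by (simp add: map_loss_def fun_eq_iff)
  qed
  have f_hoelder: "\<bar>f u - f t\<bar> \<le> L0 * \<bar>u - t\<bar> powr \<alpha>" if "u \<in> {0..1}" "t \<in> {0..1}" for u t
    using hoelder that f_eq by simp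
  obtain M0 where M0: "\<forall>\<^sub>F n in sequentially. \<forall>j. 1 \<le> j \<and> j \<le> kn n \<longrightarrow> tau n j - tau n (j - 1) \<le> M0 / real (kn n)"
    using grid_max by blast
  define M where "M = max M0 1"
  have "M > 0" by (simp add: M_def)
  obtain CK where CK: "CK > 0" "\<forall>\<^sub>F n in sequentially. norm (real (kn n)) \<le> CK * norm (real n)"
    using landau_o.bigE[OF kn_upper] by blast
  define \<gamma>0 where "\<gamma>0 = 1 / (2 * \<alpha> + 1)"
  \<comment> \<open>Any exponent strictly between that of \<open>r\<close> and 1 would do: the grid
    then has at least \<open>2 * r\<close> cells for large \<open>n\<close>, enough for the
    reference partition.\<close>
  define \<gamma> where "\<gamma> = (1 + \<gamma>0) / 2"
  have "0 < \<gamma>0" "\<gamma>0 < 1" using alpha by (auto simp: \<gamma>0_def)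
  then have \<gamma>: "0 < \<gamma>0" "\<gamma>0 < \<gamma>" "\<gamma> < 1" by (auto simp: \<gamma>_def)
  obtain c' where c': "c' > 0" "\<forall>\<^sub>F n in sequentially. norm (real n powr \<gamma>) \<le> c' * norm (real (kn n))"
    using landau_o.bigE[OF kn_lower[of \<gamma>]] \<gamma> by auto
  \<comment> \<open>Turns \<open>kn n \<le> CK * n\<close> into \<open>kn n \<le> n * n\<close>,
    which gives \<open>ln (kn n) \<le> 2 * ln n\<close>.\<close>
  have e1: "\<forall>\<^sub>F n in sequentially. CK \<le> real n" by real_asymp
  have e2: "\<forall>\<^sub>F n in sequentially. 1 \<le> ln (real n)" by real_asymp
  have e3: "\<forall>\<^sub>F n in sequentially. ln (real n) \<le> real n" by real_asymp
  have e4: "\<forall>\<^sub>F n in sequentially. 2 * c' * real n powr \<gamma>0 \<le> real n powr \<gamma>"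
  proof -
    have "\<forall>\<^sub>F n in sequentially. 2 * c' \<le> real n powr (\<gamma> - \<gamma>0)"
    proof -
      have "filterlim (\<lambda>n. real n powr (\<gamma> - \<gamma>0)) at_top sequentially"
        using \<gamma> by real_asymp
      then show ?thesis by (simp add: filterlim_at_top)
    qed
    then show ?thesis
    proof eventually_elim
      case (elim n)
      then have "2 * c' * real n powr \<gamma>0 \<le> real n powr (\<gamma> - \<gamma>0) * real n powr \<gamma>0" by (intro mult_right_mono) auto
      then show ?case by (simp flip: powr_add)
    qed
  qed
  have "\<forall>\<^sub>F n in sequentially.
     (\<integral>\<^sup>+ x. ennreal (map_loss f0 n (kn n) (p n) (a n) (tau n) x) \<partial>sample_measure f0 n)
       \<le> ennreal (rate_const \<sigma> \<Sigma> D1 D2 d1 d2 (L0\<^sup>2 * (2 * M) powr (2 * \<alpha>) / c)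
          * ((real n / ln (real n)) powr (- \<alpha> / (2 * \<alpha> + 1))) ^ 2)"
    using M0 CK(2) c'(2) e1 e2 e3 e4 eventually_ge_at_top[of 1]
  proof eventually_elim
    case (elim n)
    define r where "r = (real n / ln (real n)) powr (1 / (2 * \<alpha> + 1))"
    have n1: "n \<ge> 1" by (rule elim)
    have lpos: "ln (real n) > 0" using elim(5) by linarith
    have nL: "1 \<le> real n / ln (real n)" by (rule le_divide_eq_1_pos[THEN iffD2, OF lpos elim(6)])
    have "0 \<le> 1 / (2 * \<alpha> + 1)" using alpha by simp
    with nL have r1: "r \<ge> 1" unfolding r_def by (rule ge_one_powr_ge_zero)
    have rK: "nat \<lceil>r\<rceil> \<le> kn n"
    proof -
      have "real n / ln (real n) \<le> real n / 1"
        using elim(5) by (rule divide_left_mono) (use lpos in \<open>simp_all only: mult_1_right of_nat_0_le_iff\<close>)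
      then have *: "real n / ln (real n) \<le> real n" unfolding div_by_1 .
      have "r \<le> real n powr \<gamma>0" unfolding r_def \<gamma>0_def
      proof (rule powr_mono2[OF _ _ *])
        show "0 \<le> 1 / (2 * \<alpha> + 1)" using alpha by simp
        show "0 \<le> real n / ln (real n)" using nL by linarith
      qed
      then have "c' * (2 * r) \<le> c' * (2 * real n powr \<gamma>0)" using c'(1) by (intro mult_left_mono) auto
      also have "\<dots> = 2 * c' * real n powr \<gamma>0" by (simp only: mult_ac)
      also have "\<dots> \<le> c' * real (kn n)" using elim(3,7) by (simp only: real_norm_def abs_of_nat)
      finally have "2 * r \<le> real (kn n)" using c'(1) by simp
      moreover have "real (nat \<lceil>r\<rceil>) \<le> 2 * r" using r1 by linarith
      ultimately show ?thesis by linarith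
    qed
    have lnK: "ln (real (kn n)) \<le> 2 * ln (real n)"
    proof -
      have "real (kn n) \<le> CK * real n" using elim(2) by simp
      also have "\<dots> \<le> real n * real n" using elim(4) by (intro mult_right_mono) auto
      finally have "ln (real (kn n)) \<le> ln (real n * real n)" using kn_pos[of n] n1 by (intro ln_mono) auto
      then show ?thesis using n1 by (simp add: ln_mult)
    qed
    interpret map_model "kn n" "tau n" f c n "p n" "a n" \<sigma> \<Sigma> "ln (real n)" r D1 d1
    proof
      show "1 \<le> kn n" "tau n 0 = 0" "tau n (kn n) = 1" by (rule kn_pos grid0 grid1)+
      show "tau n (j - 1) < tau n j" if "1 \<le> j" "j \<le> kn n" for j using that by (rule grid_mono)
      show "1 \<le> ln (real n)" by (rule elim)
      show "\<sigma> / real (nbins js) \<le> a n js j \<and> a n js j \<le> \<Sigma>"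
        if "js \<in> partitions (kn n)" "j \<in> {1..nbins js}" for js j using a_bounds that by simp
      show "D1 * exp (- d1 * real k * ln (real k)) \<le> p n k" if "k \<in> {1..kn n}" for k
        using p_bounds that by simp
    qed (fact f_borel c f_int f_one n1 lnK r1 p_sum D_pos sig_pos refl)+
    show ?case unfolding loss sample
    proof (rule map_loss_rate[OF r_def alpha rK _ D_pos(2) D_pos(4) f_hoelder L0 _ \<open>M > 0\<close>])
      show "p n k \<le> D2 * exp (- d2 * real k * ln (real k))" if "k \<in> {1..kn n}" for k
        using p_bounds that by simp
      show "tau n j - tau n (j - 1) \<le> M / real (kn n)" if "1 \<le> j" "j \<le> kn n" for j
      proof -
        have "tau n j - tau n (j - 1) \<le> M0 / real (kn n)" using elim that by blast
        also have "\<dots> \<le> M / real (kn n)" by (intro divide_right_mono) (auto simp: M_def)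
        finally show ?thesis .
      qed
    qed
  qed
  then show ?thesis
    by (intro exI[of _ "rate_const \<sigma> \<Sigma> D1 D2 d1 d2 (L0\<^sup>2 * (2 * M) powr (2 * \<alpha>) / c)"])
qed

end
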